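(* For every weak composition $a$ of length $n$, \[\mathfrak{Q}_a=\sum_{\substack{b\ge a\\ \mathrm{flat}(b)=\mathrm{flat}(a)}}\mathcal{A}_b,\] where $b$ ranges over weak compositions of length $n$.
   Context: A weak composition of length $n$ is a sequence of $n$ nonnegative integers; $\mathrm{flat}(a)$ deletes zero parts; $b\ge a$ means $b_1+\cdots+b_i\ge a_1+\cdots+a_i$ for all $i$. $D(a)$: $a_i$ left-justified boxes in row $i$, row 1 lowest, columns numbered from the left. For a filling $S$ with positive integers, $x^{\mathrm{wt}(S)}=\prod_i x_i^{\#\{\text{entries } i\}}$. Demazure atom: a triple of $D(a)$ (rows $r<s$) is either Type A: boxes $\gamma=(r,c),\alpha=(r,c+1),\beta=(s,c+1)$ with $a_r\ge a_s$, or Type B: $\gamma=(s,c),\alpha=(s,c+1),\beta=(r,c)$ with $a_s>a_r$; it is an inversion triple if $\beta>\gamma\ge\alpha$ or $\gamma\ge\alpha>\beta$. $\mathcal{A}_a=\sum x^{\mathrm{wt}(S)}$ over fillings $S$ of $D(a)$ with positive integers whose rows weakly decrease left to right, whose column entries are distinct, all of whose triples are inversion triples, and whose first-column entry in each nonempty row $i$ equals $i$. Quasi-key tableau of shape $a$: filling of $D(a)$ with positive integers such that (1) entries weakly decrease along rows and no entry of row $i$ exceeds $i$; (2) entries in each column are distinct and increase going up the first column; (3) if an entry $i$ is above an entry $k$ in the same column with $i<k$, there is an entry $j$ immediately right of $k$ with $i<j$; (4) for two rows with the higher row strictly longer, if $i$ is in column $c$ of the lower row and $j$ in column $c+1$ of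 the higher row, then $i<j$. $\mathfrak{Q}_a=\sum x^{\mathrm{wt}(T)}$ over quasi-key tableaux $T$ of shape $a$. *)

theory Defs
  imports Main
begin

text \<open>Weak compositions of length n are lists of naturals of length n.
 Row r (1-indexed, row 1 lowest) has length a ! (r - 1).
 Boxes are pairs (row, column), both 1-indexed.\<close>

definition rowlen :: "nat list \<Rightarrow> nat \<Rightarrow> nat" where
  "rowlen a r = a ! (r - 1)"

definition diagram :: "nat list \<Rightarrow> (nat \<times> nat) set" where
  "diagram a = {(r, c). 1 \<le> r \<and> r \<le> length a \<and> 1 \<le> c \<and> c \<le> rowlen a r}"

definition flat :: "nat list \<Rightarrow> nat list" where
  "flat a = filter (\<lambda>x. x \<noteq> 0) a"

definition dominates :: "nat list \<Rightarrow> nat list \<Rightarrow> bool" where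
  "dominates b a \<longleftrightarrow> (\<forall>i \<le> length a. sum_list (take i a) \<le> sum_list (take i b))"

definition is_filling :: "nat list \<Rightarrow> (nat \<times> nat \<Rightarrow> nat) \<Rightarrow> bool" where
  "is_filling a S \<longleftrightarrow> (\<forall>p \<in> diagram a. 1 \<le> S p) \<and> (\<forall>p. p \<notin> diagram a \<longrightarrow> S p = 0)"

definition rows_weakly_decr :: "nat list \<Rightarrow> (nat \<times> nat \<Rightarrow> nat) \<Rightarrow> bool" where
  "rows_weakly_decr a S \<longleftrightarrow>
     (\<forall>r c. (r, c) \<in> diagram a \<and> (r, c + 1) \<in> diagram a \<longrightarrow> S (r, c + 1) \<le> S (r, c))"

definition cols_distinct :: "nat list \<Rightarrow> (nat \<times> nat \<Rightarrow> nat) \<Rightarrow> bool" where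
  "cols_distinct a S \<longleftrightarrow>
     (\<forall>r s c. (r, c) \<in> diagram a \<and> (s, c) \<in> diagram a \<and> r \<noteq> s \<longrightarrow> S (r, c) \<noteq> S (s, c))"

definition inv_triple :: "nat \<Rightarrow> nat \<Rightarrow> nat \<Rightarrow> bool" where
  "inv_triple \<gamma> \<alpha> \<beta> \<longleftrightarrow> (\<beta> > \<gamma> \<and> \<gamma> \<ge> \<alpha>) \<or> (\<gamma> \<ge> \<alpha> \<and> \<alpha> > \<beta>)"

definition all_inv_triples :: "nat list \<Rightarrow> (nat \<times> nat \<Rightarrow> nat) \<Rightarrow> bool" where
  "all_inv_triples a S \<longleftrightarrow>
    (\<forall>r s c. r < s \<and> (r, c) \<in> diagram a \<and> (r, c + 1) \<in> diagram a \<and> (s, c + 1) \<in> diagram a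
        \<and> rowlen a r \<ge> rowlen a s \<longrightarrow> inv_triple (S (r, c)) (S (r, c + 1)) (S (s, c + 1)))
  \<and> (\<forall>r s c. r < s \<and> (s, c) \<in> diagram a \<and> (s, c + 1) \<in> diagram a \<and> (r, c) \<in> diagram a
        \<and> rowlen a s > rowlen a r \<longrightarrow> inv_triple (S (s, c)) (S (s, c + 1)) (S (r, c)))"

definition atom_fillings :: "nat list \<Rightarrow> (nat \<times> nat \<Rightarrow> nat) set" where
  "atom_fillings a = {S. is_filling a S \<and> rows_weakly_decr a S \<and> cols_distinct a S
      \<and> all_inv_triples a S \<and> (\<forall>i. (i, 1) \<in> diagram a \<longrightarrow> S (i, 1) = i)}"

definition quasi_key_tableaux :: "nat list \<Rightarrow> (nat \<times> nat \<Rightarrow> nat) set" where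
  "quasi_key_tableaux a = {T. is_filling a T
      \<and> rows_weakly_decr a T \<and> (\<forall>r c. (r, c) \<in> diagram a \<longrightarrow> T (r, c) \<le> r)
      \<and> cols_distinct a T
      \<and> (\<forall>r s. r < s \<and> (r, 1) \<in> diagram a \<and> (s, 1) \<in> diagram a \<longrightarrow> T (r, 1) < T (s, 1))
      \<and> (\<forall>r s c. r < s \<and> (r, c) \<in> diagram a \<and> (s, c) \<in> diagram a \<and> T (s, c) < T (r, c)
           \<longrightarrow> (r, c + 1) \<in> diagram a \<and> T (s, c) < T (r, c + 1))
      \<and> (\<forall>r s c. r < s \<and> rowlen a r < rowlen a s \<and> (r, c) \<in> diagram a \<and> (s, c + 1) \<in> diagram a
           \<longrightarrow> T (r, c) < T (s, c + 1))}"

text \<open>Polynomials evaluated at an arbitrary point x of an arbitrary commutative semiring: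
 x^{wt(S)} = product of x_{S(p)} over the boxes p of D(a).\<close>
definition monom :: "nat list \<Rightarrow> (nat \<Rightarrow> 'a::comm_semiring_1) \<Rightarrow> (nat \<times> nat \<Rightarrow> nat) \<Rightarrow> 'a" where
  "monom a x S = (\<Prod>p \<in> diagram a. x (S p))"

definition atom :: "nat list \<Rightarrow> (nat \<Rightarrow> 'a::comm_semiring_1) \<Rightarrow> 'a" where
  "atom a x = (\<Sum>S \<in> atom_fillings a. monom a x S)"

definition quasikey :: "nat list \<Rightarrow> (nat \<Rightarrow> 'a::comm_semiring_1) \<Rightarrow> 'a" where
  "quasikey a x = (\<Sum>T \<in> quasi_key_tableaux a. monom a x T)"

end

theory Submission
  imports Defs
begin

text \<open>Both families of tableaux are determined by their column sets, and the bijection preserves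
  these sets. An atom filling is obtained from its columns by a greedy procedure from left to right:
  row by row from the bottom, take the largest unused entry not exceeding the entry to the left.
  A quasi-key tableau is obtained from its columns and its shape by a greedy procedure from right to
  left: longer rows first, lower rows first among equal lengths, take the smallest unused entry not
  below the entry to the right.

  The shapes agree up to moving each row to the height of its first entry. Follow the rows as
  vertex-disjoint paths through the columns: in both cases the first entries of the rows of length
  at least \<open>k\<close> form the smallest subset of the first column that can be linked to all of column \<open>k\<close>
  by weakly decreasing paths. For quasi-key tableaux this is a direct count; for atom fillings it
  follows from a minimal vertex cut, as in Menger's theorem.\<close>

section \<open>Greedy descriptions of the two families\<close>

text \<open>The monomial of a tableau depends only on its column sets, so no rule for moving entries
  between rows is needed, and the difficulty lies in the shape. For an atom filling the columns also
  give the shape, since row r starts with r. For a quasi-key tableau they do not: its greedy order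
  already uses the row lengths. Hence both directions of the bijection need to know which first
  entries belong to rows of which length. Neither greedy procedure gets stuck, by a Hall-type
  condition: the number of entries \<ge> v never grows from one column to the next. For the
  comparison of shapes, let X and Y be the sets of first entries of the rows of length at least k in
  the two tableaux. They have the same size, and for every t the set X has at most as many elements
  \<le> t, and at most as many elements > t, as Y. So all these bounds are equalities.\<close>

definition row_length :: "nat list \<Rightarrow> nat \<Rightarrow> nat" where
  "row_length a r = (if 1 \<le> r \<and> r \<le> length a then a ! (r - 1) else 0)"

text \<open>The value 0 marks a missing box. A set loses no multiplicities, because the entries in a
  column of a filling are distinct.\<close>

definition column :: "(nat \<times> nat \<Rightarrow> nat) \<Rightarrow> nat \<Rightarrow> nat set" where
  "column S c = range (\<lambda>r. S (r, c)) - {0}"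

text \<open>The shape \<open>L\<close> is a finitely supported function, so that rows can be
  relocated without list indices. Decrease is also required across the end of a row, where the next
  entry is 0; column 0 is exempt because it is identically 0.\<close>

definition filling :: "(nat \<Rightarrow> nat) \<Rightarrow> (nat \<times> nat \<Rightarrow> nat) \<Rightarrow> bool" where
  "filling L S \<longleftrightarrow> finite {r. 0 < L r}
     \<and> (\<forall>r c. 0 < S (r, c) \<longleftrightarrow> 1 \<le> c \<and> c \<le> L r)
     \<and> (\<forall>r c. 1 \<le> c \<longrightarrow> S (r, Suc c) \<le> S (r, c))
     \<and> (\<forall>r s c. 0 < S (r, c) \<longrightarrow> S (r, c) = S (s, c) \<longrightarrow> r = s)"

text \<open>The last condition merges the two types of triples; entries outside the shape are 0, so it also
  covers rows that have ended.\<close>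

definition skyline :: "(nat \<Rightarrow> nat) \<Rightarrow> (nat \<times> nat \<Rightarrow> nat) \<Rightarrow> bool" where
  "skyline L S \<longleftrightarrow> filling L S \<and> (\<forall>r. 0 < L r \<longrightarrow> S (r, 1) = r)
     \<and> (\<forall>r s c. r < s \<longrightarrow> 1 \<le> c \<longrightarrow> S (s, Suc c) \<le> S (r, c) \<longrightarrow> S (s, Suc c) \<le> S (r, Suc c))"

definition precedes :: "(nat \<Rightarrow> nat) \<Rightarrow> nat \<Rightarrow> nat \<Rightarrow> bool" where
  "precedes L r s \<longleftrightarrow> L s < L r \<or> L r = L s \<and> r < s"

text \<open>Conditions (3) and (4) for quasi-key tableaux in a single rule, valid once the first column
  increases.\<close>

definition keylike :: "(nat \<Rightarrow> nat) \<Rightarrow> (nat \<times> nat \<Rightarrow> nat) \<Rightarrow> bool" where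
  "keylike L T \<longleftrightarrow> filling L T
     \<and> (\<forall>r s c. precedes L r s \<longrightarrow> 0 < T (s, c) \<longrightarrow> T (r, Suc c) \<le> T (s, c) \<longrightarrow> T (r, c) \<le> T (s, c))"

section \<open>Elementary facts on fillings and counts of large entries in a column\<close>

lemma column_iff: "v \<in> column S c \<longleftrightarrow> v \<noteq> 0 \<and> (\<exists>r. S (r, c) = v)"
  unfolding column_def by auto

lemma fillingD:
  assumes "filling L S"
  shows "finite {r. 0 < L r}" "0 < S (r, c) \<longleftrightarrow> 1 \<le> c \<and> c \<le> L r"
    "1 \<le> c \<Longrightarrow> S (r, Suc c) \<le> S (r, c)"
    "0 < S (r, c) \<Longrightarrow> S (r, c) = S (s, c) \<Longrightarrow> r = s"
  using assms unfolding filling_def by blast+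

lemma skylineD:
  assumes "skyline L S"
  shows "filling L S" "0 < L r \<Longrightarrow> S (r, 1) = r"
    "r < s \<Longrightarrow> 1 \<le> c \<Longrightarrow> S (s, Suc c) \<le> S (r, c) \<Longrightarrow> S (s, Suc c) \<le> S (r, Suc c)"
  using assms unfolding skyline_def by simp_all

lemma keylikeD:
  assumes "keylike L T"
  shows "filling L T"
    "precedes L r s \<Longrightarrow> 0 < T (s, c) \<Longrightarrow> T (r, Suc c) \<le> T (s, c) \<Longrightarrow> T (r, c) \<le> T (s, c)"
  using assms unfolding keylike_def by simp_all

lemma filling_zero:
  assumes "filling L S"
  shows "S (r, c) = 0 \<longleftrightarrow> c = 0 \<or> L r < c"
  using fillingD(2)[OF assms, of r c] by auto

lemma filling_mono:
  assumes "filling L S" "1 \<le> c" "c \<le> d"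
  shows "S (r, d) \<le> S (r, c)"
  using assms(3)
proof (induction rule: dec_induct)
  case (step n)
  then show ?case using fillingD(3)[OF assms(1), of n r] assms(2) by linarith
qed simp

lemma filling_finite_rows:
  assumes "filling L S" "1 \<le> k"
  shows "finite {r. k \<le> L r}"
  by (rule finite_subset[OF _ fillingD(1)[OF assms(1)]]) (use assms(2) in auto)

lemma filling_inj:
  assumes "filling L S" "1 \<le> c"
  shows "inj_on (\<lambda>r. S (r, c)) {r. c \<le> L r}"
  by (rule inj_onI) (use assms fillingD(2,4)[OF assms(1)] in blast)

lemma column_eq:
  assumes "filling L S" "1 \<le> c"
  shows "column S c = (\<lambda>r. S (r, c)) ` {r. c \<le> L r}"
  unfolding column_def using assms filling_zero[OF assms(1)] by fastforce

lemma card_column: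
  assumes "filling L S" "1 \<le> c"
  shows "card (column S c) = card {r. c \<le> L r}"
  using column_eq[OF assms] card_image[OF filling_inj[OF assms]] by simp

lemma finite_column:
  assumes "filling L S" "1 \<le> c"
  shows "finite (column S c)"
  using column_eq[OF assms] filling_finite_rows[OF assms] by simp

lemma column_0: "filling L S \<Longrightarrow> column S 0 = {}"
  unfolding column_def using filling_zero by fastforce

lemma filling_bounded:
  assumes "filling L S"
  obtains K where "\<And>r. L r \<le> K"
proof -
  have "finite (L ` {r. 0 < L r})" using fillingD(1)[OF assms] by simp
  then have "\<forall>r. L r \<le> Max (insert 0 (L ` {r. 0 < L r}))"
    by (auto intro!: Max_ge)
  then show ?thesis using that by blast
qed

lemma card_column_ge:
  assumes "filling L S" "1 \<le> c" "0 < v"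
  shows "card {x \<in> column S c. v \<le> x} = card {r. v \<le> S (r, c)}"
proof -
  have sub: "{r. v \<le> S (r, c)} \<subseteq> {r. c \<le> L r}"
    using fillingD(2)[OF assms(1)] assms(3) by (auto dest: order.strict_trans2)
  have "{x \<in> column S c. v \<le> x} = (\<lambda>r. S (r, c)) ` {r. v \<le> S (r, c)}"
    unfolding column_def using assms(3) by auto
  then show ?thesis
    using card_image[OF inj_on_subset[OF filling_inj[OF assms(1,2)] sub]] by simp
qed

text \<open>A row with an entry \<ge> v in column c + 1 has one in column c. This is the Hall-type
  condition that feeds both greedy constructions.\<close>

lemma card_column_Suc_ge:
  assumes "filling L S" "1 \<le> c" "0 < v"
  shows "card {x \<in> column S (Suc c). v \<le> x} \<le> card {x \<in> column S c. v \<le> x}"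
proof -
  have "{r. v \<le> S (r, c)} \<subseteq> {r. c \<le> L r}"
    using fillingD(2)[OF assms(1)] assms(3) by (auto dest: order.strict_trans2)
  then have fin: "finite {r. v \<le> S (r, c)}"
    using filling_finite_rows[OF assms(1,2)] finite_subset by blast
  have "{r. v \<le> S (r, Suc c)} \<subseteq> {r. v \<le> S (r, c)}"
    using fillingD(3)[OF assms(1,2)] le_trans by blast
  then show ?thesis
    using card_mono[OF fin] card_column_ge[OF assms] card_column_ge[OF assms(1) _ assms(3), of "Suc c"]
    by simp
qed

text \<open>At the lowest disagreement in the first differing column, the larger of the two entries
  occurs in the other filling in a higher row; the skyline rule then forces the smaller entry up to
  it.\<close>

lemma skyline_unique:
  assumes S: "skyline L S" and S': "skyline L' S'"
    and col: "\<And>c. column S c = column S' c"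
  shows "S = S'"
proof -
  have fS: "filling L S" and fS': "filling L' S'" using S S' unfolding skyline_def by auto
  \<comment> \<open>One-sided, and for arbitrary fillings, so that it can be used a second time with
    the roles exchanged.\<close>
  have le: "X (r, Suc c) \<le> Y (r, Suc c)"
    if X: "skyline M X" and Y: "skyline N Y"
      and cXY: "\<And>c. column X c = column Y c"
      and c: "1 \<le> c" and eq: "\<And>r. X (r, c) = Y (r, c)"
      and lower: "\<And>q. q < r \<Longrightarrow> X (q, Suc c) = Y (q, Suc c)" for X Y M N r c
  proof (rule ccontr)
    assume "\<not> ?thesis"
    then have gt: "Y (r, Suc c) < X (r, Suc c)" by simp
    have fX: "filling M X" and fY: "filling N Y" using X Y unfolding skyline_def by auto
    have "X (r, Suc c) \<in> column Y (Suc c)"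
      using gt cXY[of "Suc c", symmetric] by (simp add: column_iff) blast
    then obtain s where s: "X (r, Suc c) = Y (s, Suc c)" unfolding column_def by auto
    have "\<not> s < r"
    proof
      assume "s < r"
      then have "X (r, Suc c) = X (s, Suc c)" using lower[of s] s by simp
      then show False using fillingD(4)[OF fX, of r "Suc c" s] gt \<open>s < r\<close> by simp
    qed
    moreover have "s \<noteq> r" using s gt by auto
    ultimately have "r < s" by simp
    moreover have "Y (s, Suc c) \<le> Y (r, c)"
      using s eq fillingD(3)[OF fX c, of r] by simp
    ultimately have "Y (s, Suc c) \<le> Y (r, Suc c)"
      using skylineD(3)[OF Y _ c] by simp
    then show False using s gt by simp
  qed
  \<comment> \<open>The two shapes are not assumed equal: that row r starts with r makes the first
    column set reveal which rows are nonempty.\<close>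
  have first: "X (r, 1) = (if r \<in> column X 1 then r else 0)" if "skyline M X" for M X r
  proof -
    have fX: "filling M X" and X1: "\<And>r. 0 < M r \<Longrightarrow> X (r, 1) = r"
      using that unfolding skyline_def by auto
    have "r \<in> column X 1 \<longleftrightarrow> 0 < M r"
      using column_eq[OF fX, of 1] X1 by (force simp: Suc_le_eq)
    then show ?thesis using X1 filling_zero[OF fX, of r 1] by auto
  qed
  have "S (r, c) = S' (r, c)" for r c
  proof (induction c arbitrary: r)
    case 0
    show ?case using filling_zero[OF fS, of r 0] filling_zero[OF fS', of r 0] by simp
  next
    case (Suc c)
    show ?case
    proof (cases "c = 0")
      case True
      then show ?thesis using first[OF S] first[OF S'] col by simp
    next
      case False
      then have c: "1 \<le> c" by simp
      show ?thesis
      proof (induction r rule: less_induct)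
        case (less r)
        show ?case
          using le[OF S S' col c Suc.IH, of r] le[OF S' S col[symmetric] c Suc.IH[symmetric], of r] less
          by (simp add: le_antisym)
      qed
    qed
  qed
  then show ?thesis by auto
qed

section \<open>The order of the rows in the right-to-left procedure\<close>

lemma precedes_total: "r \<noteq> s \<Longrightarrow> precedes L r s \<or> precedes L s r"
  unfolding precedes_def by auto

lemma precedes_first:
  assumes "finite A" "A \<noteq> {}"
  shows "\<exists>r\<in>A. \<forall>s\<in>A. s \<noteq> r \<longrightarrow> precedes L r s"
proof -
  define m where "m = Max (L ` A)"
  have m: "m \<in> L ` A" "\<And>s. s \<in> A \<Longrightarrow> L s \<le> m" using assms unfolding m_def by auto
  let ?B = "{r \<in> A. L r = m}"
  have B: "finite ?B" "?B \<noteq> {}" using assms m by auto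
  have "Min ?B \<in> ?B" "\<And>s. s \<in> ?B \<Longrightarrow> Min ?B \<le> s"
    using B Min_in Min_le by blast+
  then show ?thesis using m(2) unfolding precedes_def
    by (intro bexI[of _ "Min ?B"]) (auto simp: order.order_iff_strict)
qed

lemma wf_precedes:
  assumes "\<And>r. L r \<le> K"
  shows "wf {(r, s). precedes L r s}"
\<comment> \<open>Longer rows come first, so the bound \<open>K\<close> turns length into the
  decreasing measure K - L r; ties are broken by the row index.\<close>
proof (rule wf_subset[OF wf_inv_image[OF wf_lex_prod[OF wf_less_than wf_less_than]],
        where f1 = "\<lambda>r. (K - L r, r)"])
  show "{(r, s). precedes L r s} \<subseteq> inv_image (less_than <*lex*> less_than) (\<lambda>r. (K - L r, r))"
    using assms by (auto simp: precedes_def) (meson diff_less_mono2 order.strict_trans2)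
qed

text \<open>The mirror image of \<open>skyline_unique\<close>, from the last column leftwards and
  along \<open>precedes\<close> within a column. Both tableaux must have the same shape, since the
  order of the rows depends on it.\<close>

lemma keylike_unique:
  assumes T: "keylike L T" and T': "keylike L T'"
    and col: "\<And>c. column T c = column T' c"
  shows "T = T'"
proof -
  have fT: "filling L T" using T unfolding keylike_def by auto
  have fT': "filling L T'" using T' unfolding keylike_def by auto
  obtain K where K: "\<And>r. L r \<le> K" using filling_bounded[OF fT] by blast
  have le: "Y (r, c) \<le> X (r, c)"
    if X: "keylike L X" and Y: "keylike L Y"
      and cXY: "\<And>c. column X c = column Y c"
      and eq: "\<And>r. X (r, Suc c) = Y (r, Suc c)"
      and before: "\<And>q. precedes L q r \<Longrightarrow> X (q, c) = Y (q, c)" for X Y r c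
  proof (rule ccontr)
    assume "\<not> ?thesis"
    then have gt: "X (r, c) < Y (r, c)" by simp
    have fX: "filling L X" and fY: "filling L Y" using X Y unfolding keylike_def by auto
    have pos: "0 < X (r, c)"
      using gt fillingD(2)[OF fX, of r c] fillingD(2)[OF fY, of r c] by auto
    then have c: "1 \<le> c" using fillingD(2)[OF fX] by blast
    have "X (r, c) \<in> column Y c"
      using pos cXY[of c, symmetric] by (simp add: column_iff) blast
    then obtain s where s: "X (r, c) = Y (s, c)" unfolding column_def by auto
    have "\<not> precedes L s r"
      using before[of s] s gt fillingD(4)[OF fX pos, of s] by auto
    moreover have "s \<noteq> r" using s gt by auto
    ultimately have "precedes L r s" using precedes_total by blast
    moreover have "Y (r, Suc c) \<le> Y (s, c)"
      using s eq fillingD(3)[OF fX c, of r] by simp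
    moreover have "0 < Y (s, c)" using s pos by simp
    ultimately have "Y (r, c) \<le> Y (s, c)"
      using keylikeD(2)[OF Y] by simp
    then show False using s gt by simp
  qed
  \<comment> \<open>Induction on the distance to column \<open>K\<close>. Truncated subtraction puts
    the zero columns beyond \<open>K\<close> into the base case together with \<open>K\<close>
    itself.\<close>
  have "T (r, c) = T' (r, c)" if "K - c = n" for r c n
    using that
  proof (induction n arbitrary: r c)
    case 0
    show ?case
    proof (cases "c = K")
      case True
      have nxt: "T (r, Suc c) = T' (r, Suc c)" for r
        using True K[of r] filling_zero[OF fT, of r "Suc c"] filling_zero[OF fT', of r "Suc c"] by simp
      show ?thesis
      proof (induction r rule: wf_induct_rule[OF wf_precedes, of L K])
        case (2 r)
        then show ?case
          using le[OF T T' col nxt] le[OF T' T col[symmetric] nxt[symmetric]] by (simp add: le_antisym)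
      qed (rule K)
    next
      case False
      then have "L r < c" using 0 K[of r] by simp
      then show ?thesis using filling_zero[OF fT, of r c] filling_zero[OF fT', of r c] by simp
    qed
  next
    case (Suc n)
    have nxt: "T (r, Suc c) = T' (r, Suc c)" for r
      using Suc by simp
    show ?case
    proof (induction r rule: wf_induct_rule[OF wf_precedes, of L K])
      case (2 r)
      then show ?case
        using le[OF T T' col nxt] le[OF T' T col[symmetric] nxt[symmetric]] by (simp add: le_antisym)
    qed (rule K)
  qed
  then show ?thesis by auto
qed

section \<open>Existence for given columns\<close>

lemma card_ge_insert:
  assumes "finite C" "y \<in> C"
  shows "card {x \<in> C. v \<le> f x} = card {x \<in> C - {y}. v \<le> f x} + (if v \<le> f y then 1 else 0)"
proof (cases "v \<le> f y")
  case True
  then have "{x \<in> C. v \<le> f x} = insert y {x \<in> C - {y}. v \<le> f x}" using assms by auto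
  then show ?thesis using assms True by simp
next
  case False
  then have "{x \<in> C. v \<le> f x} = {x \<in> C - {y}. v \<le> f x}" by auto
  then show ?thesis using False by simp
qed

text \<open>\<open>f\<close> is the previous column by rows and \<open>g\<close> the new one, with 0
  for a row that ends. The lowest row chooses first; the point is that the Hall-type condition
  survives its choice.\<close>

lemma greedy_right:
  fixes f :: "nat \<Rightarrow> nat"
  assumes "finite R" "finite C" "0 \<notin> C"
    and "\<And>v. 0 < v \<Longrightarrow> card {x \<in> C. v \<le> x} \<le> card {r \<in> R. v \<le> f r}"
  shows "\<exists>g. (\<forall>r\<in>R. g r \<le> f r) \<and> g ` R - {0} = C
    \<and> (\<forall>r\<in>R. \<forall>s\<in>R. 0 < g r \<longrightarrow> g r = g s \<longrightarrow> r = s)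
    \<and> (\<forall>r\<in>R. \<forall>s\<in>R. r < s \<longrightarrow> g s \<le> f r \<longrightarrow> g s \<le> g r)"
  using assms
proof (induction "card R" arbitrary: R C)
  case 0
  then have R: "R = {}" by simp
  have "C = {}"
  proof (rule ccontr)
    assume "C \<noteq> {}"
    then have "card {x \<in> C. 1 \<le> x} \<noteq> 0" using 0 by (auto simp: Suc_le_eq)
    then show False using 0(5)[of 1] R by simp
  qed
  then show ?case using R by auto
next
  case (Suc n)
  define q where "q = Min R"
  have ne: "R \<noteq> {}" using Suc(2) by auto
  have q: "q \<in> R" "\<And>s. s \<in> R \<Longrightarrow> q \<le> s" using Suc(3) ne unfolding q_def by auto
  \<comment> \<open>The inserted 0 is the choice of a row for which no entry is small
    enough.\<close>
  define y where "y = Max (insert 0 {x \<in> C. x \<le> f q})"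
  have fin: "finite (insert 0 {x \<in> C. x \<le> f q})" using Suc by simp
  have "y \<in> insert 0 {x \<in> C. x \<le> f q}" unfolding y_def by (rule Max_in[OF fin]) simp
  then have yle: "y \<le> f q" and yC: "y = 0 \<or> y \<in> C" by auto
  have ymax: "x \<le> y" if "x \<in> C" "x \<le> f q" for x
    unfolding y_def by (rule Max_ge[OF fin]) (use that in simp)
  have dom: "card {x \<in> C - {y}. v \<le> x} \<le> card {r \<in> R - {q}. v \<le> f r}" if v: "0 < v" for v
  proof -
    have R: "card {r \<in> R. v \<le> f r} = card {r \<in> R - {q}. v \<le> f r} + (if v \<le> f q then 1 else 0)" for v
      using card_ge_insert[OF Suc(3) q(1)] .
    consider "v \<le> y" | "y < v" "v \<le> f q" | "f q < v" by linarith
    then show ?thesis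
    proof cases
      case 1
      then have "y \<in> C" using yC v by auto
      then show ?thesis
        using card_ge_insert[OF Suc(4), of y v id] R[of v] Suc(6)[OF v] 1 yle by simp
    next
      \<comment> \<open>No entry of \<open>C\<close> lies strictly above y and at most f q, so the
        count at v equals the count at f q + 1, where row q does not contribute.\<close>
      case 2
      have "{x \<in> C - {y}. v \<le> x} = {x \<in> C. Suc (f q) \<le> x}"
        using 2 yle ymax by (force simp: not_less_eq_eq)
      then have "card {x \<in> C - {y}. v \<le> x} \<le> card {r \<in> R. Suc (f q) \<le> f r}"
        using Suc(6)[of "Suc (f q)"] by simp
      also have "\<dots> \<le> card {r \<in> R - {q}. v \<le> f r}"
        by (rule card_mono) (use Suc(3) 2 in auto)
      finally show ?thesis .
    next
      case 3
      have "card {x \<in> C - {y}. v \<le> x} \<le> card {x \<in> C. v \<le> x}"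
        by (rule card_mono) (use Suc(4) in auto)
      then show ?thesis using R[of v] Suc(6)[OF v] 3 by simp
    qed
  qed
  have "n = card (R - {q})" "finite (R - {q})" "finite (C - {y})" "0 \<notin> C - {y}"
    using Suc(2-5) q(1) by simp_all
  from Suc(1)[OF this dom] obtain g where
    g: "\<forall>r\<in>R - {q}. g r \<le> f r" "g ` (R - {q}) - {0} = C - {y}"
      "\<forall>r\<in>R - {q}. \<forall>s\<in>R - {q}. 0 < g r \<longrightarrow> g r = g s \<longrightarrow> r = s"
      "\<forall>r\<in>R - {q}. \<forall>s\<in>R - {q}. r < s \<longrightarrow> g s \<le> f r \<longrightarrow> g s \<le> g r"
    by blast
  define h where "h = g(q := y)"
  have hq: "h q = y" and hr: "\<And>r. r \<noteq> q \<Longrightarrow> h r = g r" unfolding h_def by auto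
  have mem: "g r = 0 \<or> g r \<in> C - {y}" if "r \<in> R - {q}" for r using g(2) that by blast
  have hR: "h ` R = insert y (g ` (R - {q}))" using q(1) unfolding h_def by auto
  have "insert y A - {0} = (A - {0}) \<union> ({y} - {0})" for A by auto
  then have "h ` R - {0} = (C - {y}) \<union> ({y} - {0})" unfolding hR g(2)[symmetric] .
  also have "\<dots> = C" using yC Suc(5) by auto
  finally have "h ` R - {0} = C" .
  moreover have "\<forall>r\<in>R. h r \<le> f r" using g(1) yle unfolding h_def by auto
  moreover have "\<forall>r\<in>R. \<forall>s\<in>R. 0 < h r \<longrightarrow> h r = h s \<longrightarrow> r = s"
    using g(3) mem unfolding h_def by (metis DiffE DiffI fun_upd_apply insertCI nat_less_le singletonD)
  moreover have "\<forall>r\<in>R. \<forall>s\<in>R. r < s \<longrightarrow> h s \<le> f r \<longrightarrow> h s \<le> h r"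
  proof (intro ballI impI)
    fix r s assume rs: "r \<in> R" "s \<in> R" "r < s" "h s \<le> f r"
    then have sq: "s \<noteq> q" using q(2)[of r] by auto
    show "h s \<le> h r"
    proof (cases "r = q")
      case True
      then show ?thesis using rs sq hq hr[OF sq] mem[of s] ymax[of "g s"] by auto
    next
      case False
      then show ?thesis using rs sq hr g(4) by auto
    qed
  qed
  ultimately show ?case by blast
qed

text \<open>Here \<open>f\<close> is the column to the right and every row in \<open>R\<close> must
  receive an entry, hence the equal cardinalities and the bijection.\<close>

lemma greedy_left:
  fixes f :: "nat \<Rightarrow> nat"
  assumes "finite R" "finite C" "card R = card C"
    and "\<And>v. card {r \<in> R. v \<le> f r} \<le> card {x \<in> C. v \<le> x}"
  shows "\<exists>g. (\<forall>r\<in>R. f r \<le> g r) \<and> bij_betw g R C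
    \<and> (\<forall>r\<in>R. \<forall>s\<in>R. precedes L r s \<longrightarrow> f r \<le> g s \<longrightarrow> g r \<le> g s)"
  using assms
proof (induction "card R" arbitrary: R C)
  case 0
  then show ?case by (auto simp: bij_betw_def)
next
  case (Suc n)
  have ne: "R \<noteq> {}" using Suc(2) by auto
  obtain q where q: "q \<in> R" "\<And>s. s \<in> R \<Longrightarrow> s \<noteq> q \<Longrightarrow> precedes L q s"
    using precedes_first[OF Suc(3) ne] by blast
  have R: "card {r \<in> R. v \<le> f r} = card {r \<in> R - {q}. v \<le> f r} + (if v \<le> f q then 1 else 0)" for v
    using card_ge_insert[OF Suc(3) q(1)] .
  have fin: "finite {x \<in> C. f q \<le> x}" using Suc by simp
  \<comment> \<open>Row q itself is counted at threshold f q, so an admissible entry exists for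
    it.\<close>
  have "card {x \<in> C. f q \<le> x} \<noteq> 0" using Suc(6)[of "f q"] R[of "f q"] by simp
  then have Cne: "{x \<in> C. f q \<le> x} \<noteq> {}" by force
  define y where "y = Min {x \<in> C. f q \<le> x}"
  have yge: "f q \<le> y" and yC: "y \<in> C" using Min_in[OF fin Cne] unfolding y_def by auto
  have ymin: "y \<le> x" if "x \<in> C" "f q \<le> x" for x
    unfolding y_def by (rule Min_le[OF fin]) (use that in simp)
  have C: "card {x \<in> C. v \<le> x} = card {x \<in> C - {y}. v \<le> x} + (if v \<le> y then 1 else 0)" for v
    using card_ge_insert[OF Suc(4) yC, of v id] by simp
  have dom: "card {r \<in> R - {q}. v \<le> f r} \<le> card {x \<in> C - {y}. v \<le> x}" for v
  proof -
    consider "v \<le> f q" | "f q < v" "v \<le> y" | "y < v" by linarith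
    then show ?thesis
    proof cases
      case 1
      then show ?thesis using R[of v] C[of v] Suc(6)[of v] yge by simp
    next
      \<comment> \<open>After y is removed, every remaining entry \<ge> f q is also \<ge> y, by
        minimality of y, hence \<ge> v; the count at v is the count at f q.\<close>
      case 2
      have "card {r \<in> R - {q}. v \<le> f r} \<le> card {r \<in> R - {q}. f q \<le> f r}"
        by (rule card_mono) (use Suc(3) 2 in auto)
      also have "\<dots> \<le> card {x \<in> C - {y}. f q \<le> x}"
        using R[of "f q"] C[of "f q"] Suc(6)[of "f q"] yge by simp
      also have "{x \<in> C - {y}. f q \<le> x} = {x \<in> C - {y}. v \<le> x}"
        using 2 ymin by force
      finally show ?thesis .
    next
      case 3
      then show ?thesis using R[of v] C[of v] Suc(6)[of v] yge by simp
    qed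
  qed
  have "n = card (R - {q})" "card (R - {q}) = card (C - {y})"
    using Suc(2-5) q(1) yC by simp_all
  from Suc(1)[OF this(1) _ _ this(2) dom] Suc(3,4) obtain g where
    g: "\<forall>r\<in>R - {q}. f r \<le> g r" "bij_betw g (R - {q}) (C - {y})"
      "\<forall>r\<in>R - {q}. \<forall>s\<in>R - {q}. precedes L r s \<longrightarrow> f r \<le> g s \<longrightarrow> g r \<le> g s"
    by auto
  define h where "h = g(q := y)"
  have hq: "h q = y" and hr: "\<And>r. r \<noteq> q \<Longrightarrow> h r = g r" unfolding h_def by auto
  have "bij_betw h (R - {q}) (C - {y})"
    using g(2) bij_betw_cong[of "R - {q}" h g] hr by auto
  then have "bij_betw h ((R - {q}) \<union> {q}) ((C - {y}) \<union> {y})"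
    using notIn_Un_bij_betw[of q "R - {q}" h "C - {y}"] hq by simp
  moreover have "(R - {q}) \<union> {q} = R" "(C - {y}) \<union> {y} = C" using q(1) yC by auto
  ultimately have "bij_betw h R C" by simp
  moreover have "\<forall>r\<in>R. f r \<le> h r" using g(1) yge unfolding h_def by auto
  moreover have "\<forall>r\<in>R. \<forall>s\<in>R. precedes L r s \<longrightarrow> f r \<le> h s \<longrightarrow> h r \<le> h s"
  proof (intro ballI impI)
    fix r s assume rs: "r \<in> R" "s \<in> R" "precedes L r s" "f r \<le> h s"
    then have sq: "s \<noteq> q" using q(2)[of r] by (cases "r = q") (auto simp: precedes_def)
    then have "g s \<in> C" using g(2) rs(2) by (auto simp: bij_betw_def)
    show "h r \<le> h s"
    proof (cases "r = q")
      case True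
      then show ?thesis using rs hq hr[OF sq] ymin[OF \<open>g s \<in> C\<close>] by auto
    next
      case False
      then show ?thesis using rs sq hr g(3) by auto
    qed
  qed
  ultimately show ?case by blast
qed

text \<open>The analogue of \<open>card_column_ge\<close> for a single column given as a function of
  the row, before a whole filling has been assembled.\<close>

lemma card_ge_range:
  fixes g :: "nat \<Rightarrow> nat"
  assumes "range g - {0} = C" "{r. 0 < g r} \<subseteq> R"
    and "\<And>r s. 0 < g r \<Longrightarrow> g r = g s \<Longrightarrow> r = s" "0 < v"
  shows "card {r \<in> R. v \<le> g r} = card {x \<in> C. v \<le> x}"
proof -
  have "inj_on g {r \<in> R. v \<le> g r}"
    by (rule inj_onI) (use assms(3,4) in fastforce)
  moreover have "g ` {r \<in> R. v \<le> g r} = {x \<in> C. v \<le> x}"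
    using assms by fastforce
  ultimately show ?thesis using card_image by fastforce
qed

lemma skyline_exists:
  assumes T: "filling L T"
  shows "\<exists>L' S. skyline L' S \<and> (\<forall>c. column S c = column T c)"
proof -
  let ?R = "column T 1"
  have finR: "finite ?R" using finite_column[OF T] by simp
  define P where "P n g \<longleftrightarrow> range g - {0} = column T (Suc n) \<and> {r. 0 < g r} \<subseteq> ?R
    \<and> (\<forall>r s. 0 < g r \<longrightarrow> g r = g s \<longrightarrow> r = s)" for n and g :: "nat \<Rightarrow> nat"
  define Q where "Q g h \<longleftrightarrow> (\<forall>r. h r \<le> g r) \<and> (\<forall>r s. r < s \<longrightarrow> h s \<le> g r \<longrightarrow> h s \<le> h r)"
    for g h :: "nat \<Rightarrow> nat"
  define g0 where "g0 r = (if r \<in> ?R then r else 0)" for r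
  have "0 \<notin> ?R" unfolding column_def by simp
  then have "x \<in> range g0 - {0}" if "x \<in> ?R" for x
    using that by (intro DiffI range_eqI[of _ _ x]) (auto simp: g0_def intro!: Nat.gr0I)
  then have "range g0 - {0} = ?R" by (auto simp: g0_def split: if_splits)
  then have P0: "P 0 g0" unfolding P_def by (auto simp: g0_def)
  \<comment> \<open>\<open>G n\<close> is column n + 1. The clause on n = 0 pins the first column to
    \<open>g0\<close>, where each entry is its own row index.\<close>
  have "\<exists>G. \<forall>n. (P n (G n) \<and> (n = 0 \<longrightarrow> G n = g0)) \<and> Q (G n) (G (Suc n))"
  proof (rule dependent_nat_choice)
    show "\<exists>g. P 0 g \<and> (0 = (0::nat) \<longrightarrow> g = g0)" using P0 by blast
  next
    fix g n assume "P n g \<and> (n = 0 \<longrightarrow> g = g0)"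
    then have "P n g" by simp
    then have g: "range g - {0} = column T (Suc n)" "{r. 0 < g r} \<subseteq> ?R"
      "\<And>r s. 0 < g r \<Longrightarrow> g r = g s \<Longrightarrow> r = s"
      unfolding P_def by simp_all
    let ?C = "column T (Suc (Suc n))"
    have "card {x \<in> ?C. v \<le> x} \<le> card {r \<in> ?R. v \<le> g r}" if v: "0 < v" for v
      using card_column_Suc_ge[OF T _ v, of "Suc n"] card_ge_range[OF g v] by simp
    moreover have "finite ?C" "0 \<notin> ?C" using finite_column[OF T] by (auto simp: column_def)
    ultimately obtain h where h: "\<forall>r\<in>?R. h r \<le> g r" "h ` ?R - {0} = ?C"
      "\<forall>r\<in>?R. \<forall>s\<in>?R. 0 < h r \<longrightarrow> h r = h s \<longrightarrow> r = s"
      "\<forall>r\<in>?R. \<forall>s\<in>?R. r < s \<longrightarrow> h s \<le> g r \<longrightarrow> h s \<le> h r"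
      using greedy_right[OF finR, of ?C g] by auto
    define h' where "h' r = (if r \<in> ?R then h r else 0)" for r
    have "range h' - {0} = ?C" using h(2) unfolding h'_def by (auto simp: image_iff)
    then have "P (Suc n) h'" unfolding P_def using h(3) by (auto simp: h'_def)
    moreover have "Q g h'"
      unfolding Q_def
    proof (intro conjI allI impI)
      show "h' r \<le> g r" for r using h(1) by (simp add: h'_def)
      fix r s :: nat assume rs: "r < s" "h' s \<le> g r"
      show "h' s \<le> h' r"
      proof (cases "r \<in> ?R")
        case True
        then show ?thesis using rs h(4) by (auto simp: h'_def)
      next
        case False
        then have "g r = 0" using g(2) by auto
        then show ?thesis using rs by simp
      qed
    qed
    ultimately show "\<exists>h. (P (Suc n) h \<and> (Suc n = 0 \<longrightarrow> h = g0)) \<and> Q g h" by blast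
  qed
  then obtain G where G: "\<And>n. P n (G n)" "G 0 = g0" "\<And>n. Q (G n) (G (Suc n))" by auto
  define S where "S = (\<lambda>(r, c). if c = 0 then 0 else G (c - 1) r)"
  have S0: "S (r, 0) = 0" and SS: "S (r, Suc c) = G c r" for r c unfolding S_def by auto
  have col: "column S c = column T c" for c
    using G(1)[of "c - 1"] column_0[OF T]
    by (cases c) (auto simp: column_def S0 SS P_def)
  have decr: "S (r, Suc c) \<le> S (r, c)" if "1 \<le> c" for r c
    using that G(3)[of "c - 1"] SS[of r c] SS[of r "c - 1"] unfolding Q_def by simp
  obtain K where K: "\<And>r. L r \<le> K" using filling_bounded[OF T] by blast
  have "column T (Suc K) = {}"
    using column_eq[OF T, of "Suc K"] K by (auto simp: not_less_eq_eq[symmetric])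
  then have SK: "S (r, Suc K) = 0" for r
    using col[of "Suc K"] column_iff[of "S (r, Suc K)" S "Suc K"] by simp blast
  \<comment> \<open>The shape is an output of the construction: a row ends just before its first
    zero.\<close>
  define L' where "L' r = (LEAST c. S (r, Suc c) = 0)" for r
  have L'0: "S (r, Suc (L' r)) = 0" for r
    unfolding L'_def by (rule LeastI[of _ K]) (rule SK)
  have mono: "S (r, d) \<le> S (r, c)" if "1 \<le> c" "c \<le> d" for r c d
    using that(2)
  proof (induction rule: dec_induct)
    case (step n)
    then show ?case using decr[of n r] that(1) by linarith
  qed simp
  have pos: "0 < S (r, c) \<longleftrightarrow> 1 \<le> c \<and> c \<le> L' r" for r c
  proof (cases c)
    case 0
    then show ?thesis using S0 by simp
  next
    case (Suc d)
    show ?thesis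
    proof (cases "d < L' r")
      case True
      then have "S (r, Suc d) \<noteq> 0" using not_less_Least[of d "\<lambda>c. S (r, Suc c) = 0"]
        unfolding L'_def by blast
      then show ?thesis using True Suc by simp
    next
      case False
      then have "S (r, Suc d) = 0" using L'0[of r] mono[of "Suc (L' r)" "Suc d" r] by simp
      then show ?thesis using False Suc by simp
    qed
  qed
  have "{r. 0 < L' r} \<subseteq> ?R"
  proof
    fix r assume "r \<in> {r. 0 < L' r}"
    then have "0 < G 0 r" using pos[of r 1] SS[of r 0] by simp
    then show "r \<in> ?R" using G(1)[of 0] unfolding P_def by blast
  qed
  then have "finite {r. 0 < L' r}" using finR finite_subset by blast
  moreover have "r = s" if "0 < S (r, c)" "S (r, c) = S (s, c)" for r s c
    using that G(1)[of "c - 1"] S0 SS unfolding P_def by (cases c) auto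
  ultimately have "filling L' S" unfolding filling_def using pos decr by blast
  moreover have "S (r, 1) = r" if "0 < L' r" for r
    using that pos[of r 1] SS[of r 0] G(2) by (auto simp: g0_def split: if_splits)
  moreover have "S (s, Suc c) \<le> S (r, Suc c)" if "r < s" "1 \<le> c" "S (s, Suc c) \<le> S (r, c)" for r s c
    using that G(3)[of "c - 1"] SS[of _ c] SS[of _ "c - 1"] unfolding Q_def by auto
  ultimately have "skyline L' S" unfolding skyline_def by blast
  then show ?thesis using col by blast
qed

text \<open>The shape is an input here. Apart from finite support it only has to provide, for every
  c, as many rows reaching column c as there are entries in it.\<close>

lemma keylike_exists:
  assumes S: "filling L0 S" and fin: "finite {r. 0 < L r}"
    and cards: "\<And>c. 1 \<le> c \<Longrightarrow> card {r. c \<le> L r} = card {r. c \<le> L0 r}"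
  shows "\<exists>T. keylike L T \<and> (\<forall>c. column T c = column S c)"
proof -
  obtain K where K0: "\<And>r. L0 r \<le> K" using filling_bounded[OF S] by blast
  have finL: "finite {r. c \<le> L r}" if "1 \<le> c" for c
    by (rule finite_subset[OF _ fin]) (use that in auto)
  have K: "L r \<le> K" for r
  proof (rule ccontr)
    assume "\<not> L r \<le> K"
    then have "r \<in> {r. Suc K \<le> L r}" by simp
    then have "card {r. Suc K \<le> L r} \<noteq> 0" using finL[of "Suc K"] card_0_eq by fastforce
    moreover have "{r. Suc K \<le> L0 r} = {}" using K0 by (auto simp: not_less_eq_eq[symmetric])
    ultimately show False using cards[of "Suc K"] by simp
  qed
  \<comment> \<open>Stage n is column K + 1 - n, beginning with the empty column K + 1. Dependent
    choice produces an infinite sequence, so the conditions become vacuous once column 1 has been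
    built.\<close>
  define P where "P n h \<longleftrightarrow> (n \<le> K \<longrightarrow> (\<forall>r. 0 < h r \<longleftrightarrow> Suc K - n \<le> L r)
    \<and> range h - {0} = column S (Suc K - n) \<and> (\<forall>r s. 0 < h r \<longrightarrow> h r = h s \<longrightarrow> r = s))"
    for n and h :: "nat \<Rightarrow> nat"
  define Q where "Q n h h' \<longleftrightarrow> (Suc n \<le> K \<longrightarrow> (\<forall>r. h r \<le> h' r)
    \<and> (\<forall>r s. precedes L r s \<longrightarrow> 0 < h' s \<longrightarrow> h r \<le> h' s \<longrightarrow> h' r \<le> h' s))"
    for n and h h' :: "nat \<Rightarrow> nat"
  have "\<exists>H. \<forall>n. P n (H n) \<and> Q n (H n) (H (Suc n))"
  proof (rule dependent_nat_choice)
    have "column S (Suc K) = {}"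
      using column_eq[OF S, of "Suc K"] K0 by (auto simp: not_less_eq_eq[symmetric])
    then have "P 0 (\<lambda>r. 0)" unfolding P_def using K by (auto simp: not_less_eq_eq[symmetric])
    then show "\<exists>h. P 0 h" by blast
  next
    fix h n assume h: "P n h"
    show "\<exists>h'. P (Suc n) h' \<and> Q n h h'"
    proof (cases "Suc n \<le> K")
      case False
      then show ?thesis unfolding P_def Q_def by auto
    next
      case True
      define c where "c = K - n"
      have c: "1 \<le> c" "Suc K - n = Suc c" "Suc K - Suc n = c" using True unfolding c_def by auto
      have hp: "\<And>r. 0 < h r \<longleftrightarrow> Suc c \<le> L r" "range h - {0} = column S (Suc c)"
        "\<And>r s. 0 < h r \<Longrightarrow> h r = h s \<Longrightarrow> r = s"
        using h True c(2) unfolding P_def by auto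
      let ?R = "{r. c \<le> L r}" and ?C = "column S c"
      have cRC: "card ?R = card ?C" using card_column[OF S c(1)] cards[OF c(1)] by simp
      have C0: "0 \<notin> ?C" unfolding column_def by simp
      have sub: "{r. 0 < h r} \<subseteq> ?R" using hp(1) by auto
      have "card {r \<in> ?R. v \<le> h r} \<le> card {x \<in> ?C. v \<le> x}" for v
      proof (cases "v = 0")
        case True
        then show ?thesis using cRC by simp
      next
        case False
        then show ?thesis
          using card_ge_range[OF hp(2) sub hp(3)] card_column_Suc_ge[OF S c(1)] by simp
      qed
      from greedy_left[OF finL[OF c(1)] finite_column[OF S c(1)] cRC this] obtain g where
        g: "\<forall>r\<in>?R. h r \<le> g r" "bij_betw g ?R ?C"
          "\<forall>r\<in>?R. \<forall>s\<in>?R. precedes L r s \<longrightarrow> h r \<le> g s \<longrightarrow> g r \<le> g s"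
        by blast
      define h' where "h' r = (if r \<in> ?R then g r else 0)" for r
      have gC: "g r \<in> ?C" if "r \<in> ?R" for r using g(2) that unfolding bij_betw_def by blast
      have pos: "0 < h' r \<longleftrightarrow> c \<le> L r" for r
        using gC[of r] C0 by (auto simp: h'_def intro!: Nat.gr0I)
      have "range h' - {0} = ?C"
        using g(2) C0 unfolding bij_betw_def h'_def by (auto simp: image_iff)
      moreover have "r = s" if "0 < h' r" "h' r = h' s" for r s
        using that pos[of r] pos[of s] g(2) unfolding bij_betw_def inj_on_def h'_def by auto
      ultimately have "P (Suc n) h'" unfolding P_def c(3) using pos by blast
      moreover have "Q n h h'" unfolding Q_def
      proof (intro impI conjI allI)
        show "h r \<le> h' r" for r using g(1) sub by (auto simp: h'_def)
        fix r s assume "precedes L r s" "0 < h' s" "h r \<le> h' s"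
        then show "h' r \<le> h' s" using g(3) pos[of s] by (auto simp: h'_def)
      qed
      ultimately show ?thesis by blast
    qed
  qed
  then obtain H where H: "\<And>n. P n (H n)" "\<And>n. Q n (H n) (H (Suc n))" by blast
  define T where "T = (\<lambda>(r, c). if 1 \<le> c \<and> c \<le> K then H (Suc K - c) r else 0)"
  have T1: "T (r, c) = H (Suc K - c) r" if "1 \<le> c" "c \<le> K" for r c
    using that unfolding T_def by auto
  have T2: "T (r, c) = 0" if "c = 0 \<or> K < c" for r c
    using that unfolding T_def by auto
  have pos: "0 < T (r, c) \<longleftrightarrow> 1 \<le> c \<and> c \<le> L r" for r c
  proof (cases "1 \<le> c \<and> c \<le> K")
    case True
    then show ?thesis using H(1)[of "Suc K - c"] T1[of c r] unfolding P_def by auto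
  next
    case False
    then show ?thesis using T2[of c r] K[of r] by auto
  qed
  have col: "column T c = column S c" for c
  proof (cases "1 \<le> c \<and> c \<le> K")
    case True
    then show ?thesis using H(1)[of "Suc K - c"] T1[of c] unfolding P_def
      by (auto simp: column_def[of T])
  next
    case False
    then have "column T c = {}" using T2[of c] by (auto simp: column_def)
    moreover have "column S c = {}"
      using False filling_zero[OF S] K0 by (auto simp: column_def) (metis not_le le_trans)
    ultimately show ?thesis by simp
  qed
  have T0: "H 0 r = 0" for r using H(1)[of 0] K[of r] unfolding P_def by auto
  have Tn: "T (r, Suc c) = H (K - c) r" if "1 \<le> c" "c \<le> K" for r c
    using that T1[of "Suc c" r] T2[of "Suc c" r] T0 by (cases "c = K") auto
  have qc: "Q (K - c) (\<lambda>r. T (r, Suc c)) (\<lambda>r. T (r, c))" if "1 \<le> c" "c \<le> K" for c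
  proof -
    have "(\<lambda>r. T (r, Suc c)) = H (K - c)" "(\<lambda>r. T (r, c)) = H (Suc (K - c))"
      using Tn[OF that] T1[OF that] that by (auto simp: Suc_diff_le)
    then show ?thesis using H(2)[of "K - c"] by simp
  qed
  have decr: "T (r, Suc c) \<le> T (r, c)" if "1 \<le> c" for r c
  proof (cases "c \<le> K")
    case True
    then show ?thesis using qc[of c] that unfolding Q_def by auto
  next
    case False
    then show ?thesis using T2[of "Suc c" r] by simp
  qed
  have inj: "r = s" if "0 < T (r, c)" "T (r, c) = T (s, c)" for r s c
  proof -
    have c: "1 \<le> c" "c \<le> K" using that(1) pos[of r c] K[of r] by auto
    then show ?thesis using that H(1)[of "Suc K - c"] T1[OF c] unfolding P_def by auto
  qed
  have "filling L T" unfolding filling_def using fin pos decr inj by blast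
  moreover have "T (r, c) \<le> T (s, c)"
    if "precedes L r s" "0 < T (s, c)" "T (r, Suc c) \<le> T (s, c)" for r s c
  proof -
    have c: "1 \<le> c" "c \<le> K" using that(2) pos[of s c] K[of s] by auto
    then show ?thesis using that qc[OF c] unfolding Q_def by auto
  qed
  ultimately have "keylike L T" unfolding keylike_def by blast
  then show ?thesis using col by blast
qed

section \<open>Comparison of shapes\<close>

text \<open>The cells reachable in the residual network of the flow formed by those rows \<open>\<le> t\<close> of \<open>S\<close> that
  arrive in column \<open>k\<close>, starting from the rows that end before. The first unreachable cell in
  each arriving row gives a vertex cut separating the rows \<open>\<le> t\<close> from column \<open>k\<close>.\<close>

inductive reach :: "(nat \<times> nat \<Rightarrow> nat) \<Rightarrow> nat \<Rightarrow> nat \<Rightarrow> nat \<Rightarrow> nat \<Rightarrow> bool"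
  for S k t where
  dead: "d \<le> t \<Longrightarrow> S (d, k) = 0 \<Longrightarrow> 0 < S (d, c) \<Longrightarrow> reach S k t d c"
| detour: "reach S k t q e \<Longrightarrow> s \<le> t \<Longrightarrow> 0 < S (s, Suc e) \<Longrightarrow> S (s, Suc e) \<le> S (q, e)
    \<Longrightarrow> 1 \<le> c \<Longrightarrow> c \<le> e \<Longrightarrow> reach S k t s c"

text \<open>Rows without an entry in column k end before it, and a detour only runs backwards. So
  the arriving rows are all cut before or in column k.\<close>

lemma reach_less:
  assumes "filling L S" "1 \<le> k" "reach S k t s c"
  shows "c < k"
  using assms(3)
proof (induction rule: reach.induct)
  case (dead d c)
  then show ?case using fillingD(2)[OF assms(1), of d c] filling_zero[OF assms(1), of d k] assms(2) by auto
qed auto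

text \<open>The reachable cells of a row form an initial segment, so each row has a single first
  unreachable cell.\<close>

lemma reach_down:
  assumes "filling L S" "reach S k t s c" "1 \<le> c'" "c' \<le> c"
  shows "reach S k t s c'"
  using assms(2)
proof cases
  case dead
  then have "0 < S (s, c')" using fillingD(2)[OF assms(1)] assms(3,4) by auto
  then show ?thesis using dead reach.dead by blast
next
  case (detour q e)
  then show ?thesis using reach.detour[of S k t q e s c'] assms(3,4) by auto
qed

text \<open>Rows above \<open>t\<close> offer no way around the cut: by the skyline rule, a step
  from a reachable cell into such a row is matched by a reachable cell in the same column with an
  entry at least as large. If the row of the given cell does not provide it, the cell was reached by
  a detour starting in the same column, and the argument is repeated at the origin of that
  detour.\<close>

lemma reach_extend:
  assumes S: "skyline L S" and "reach S k t s c" "t < u" "0 < S (u, Suc c)" "S (u, Suc c) \<le> S (s, c)"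
  shows "\<exists>q. reach S k t q (Suc c) \<and> S (u, Suc c) \<le> S (q, Suc c)"
proof -
  have f: "filling L S" and
    sky: "\<And>r s c. r < s \<Longrightarrow> 1 \<le> c \<Longrightarrow> S (s, Suc c) \<le> S (r, c) \<Longrightarrow> S (s, Suc c) \<le> S (r, Suc c)"
    using skylineD[OF S] by auto
  show ?thesis
    using assms(2,4,5)
  proof (induction rule: reach.induct)
    case (dead d c)
    have "1 \<le> c" using dead fillingD(2)[OF f] by blast
    then have "S (u, Suc c) \<le> S (d, Suc c)" using sky[of d u c] dead assms(3) by simp
    then show ?case using reach.dead[of d t S k "Suc c"] dead by auto
  next
    case (detour q e s c)
    have *: "S (u, Suc c) \<le> S (s, Suc c)" using sky[of s u c] detour assms(3) by simp
    show ?case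
    proof (cases "c = e")
      case True
      then show ?thesis using detour * by auto
    next
      case False
      then have "reach S k t s (Suc c)" using reach.detour[of S k t q e s "Suc c"] detour by simp
      then show ?thesis using * by blast
    qed
  qed
qed

text \<open>The easy half of Menger's theorem: every row counted on the left crosses the cut, which
  has one cell in each arriving row \<le> t, and distinct rows of \<open>T\<close> cannot share a
  cell.\<close>

lemma card_first_column_le:
  assumes S: "skyline L S" and T: "filling L' T"
    and col: "\<And>c. column T c = column S c" and k: "1 \<le> k"
  shows "card {r. k \<le> L' r \<and> T (r, 1) \<le> t} \<le> card {r. k \<le> L r \<and> r \<le> t}"
proof -
  let ?J = "{r. k \<le> L' r \<and> T (r, 1) \<le> t}"
  have f: "filling L S" and S1: "\<And>r. 0 < L r \<Longrightarrow> S (r, 1) = r"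
    using skylineD[OF S] by auto
  define crosses where "crosses j u c \<longleftrightarrow> u \<le> t \<and> k \<le> L u \<and> 1 \<le> c \<and> c \<le> k
      \<and> T (j, c) = S (u, c) \<and> \<not> reach S k t u c \<and> (c = 1 \<or> reach S k t u (c - 1))" for j u c
  have "\<exists>u c. crosses j u c" if j: "j \<in> ?J" for j
  proof -
    define hit where "hit c \<longleftrightarrow> (\<exists>s. reach S k t s c \<and> T (j, c) \<le> S (s, c))" for c
    define c where "c = (LEAST c. 1 \<le> c \<and> \<not> hit c)"
    have "\<not> hit k" unfolding hit_def using reach_less[OF f k] by blast
    then have ck: "1 \<le> k \<and> \<not> hit k" using k by simp
    have c: "1 \<le> c" "\<not> hit c" "c \<le> k"
      using LeastI[of "\<lambda>c. 1 \<le> c \<and> \<not> hit c", OF ck] Least_le[of "\<lambda>c. 1 \<le> c \<and> \<not> hit c", OF ck]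
      unfolding c_def by blast+
    have Tpos: "0 < T (j, c)" using fillingD(2)[OF T, of j c] c j by auto
    then have "T (j, c) \<in> column S c" using col[of c, symmetric] by (simp add: column_iff) blast
    then obtain u where u: "T (j, c) = S (u, c)" unfolding column_def by auto
    have nr: "\<not> reach S k t u c" using c(2) u unfolding hit_def by auto
    have Lu: "0 < L u" using Tpos u fillingD(2)[OF f, of u c] by auto
    \<comment> \<open>In column 1 the row index u is the entry itself. Later, u > t would produce a
      hit in column c by \<open>reach_extend\<close>, so u \<le> t and a detour reaches row u in
      column c - 1.\<close>
    have ut: "u \<le> t \<and> (c = 1 \<or> reach S k t u (c - 1))"
    proof (cases "c = 1")
      case True
      then show ?thesis using u S1[OF Lu] j by simp
    next
      case False
      then obtain d where d: "c = Suc d" "1 \<le> d" using c(1) by (cases c) auto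
      have "hit d" using not_less_Least[of d "\<lambda>c. 1 \<le> c \<and> \<not> hit c"] d unfolding c_def by simp
      then obtain s where s: "reach S k t s d" "T (j, d) \<le> S (s, d)" unfolding hit_def by blast
      have le: "S (u, Suc d) \<le> S (s, d)"
        using fillingD(3)[OF T d(2), of j] s(2) u d(1) by simp
      have up: "0 < S (u, Suc d)" using Tpos u d(1) by simp
      have "u \<le> t"
      proof (rule ccontr)
        assume "\<not> u \<le> t"
        then show False
          using reach_extend[OF S s(1) _ up le] c(2) u d(1) unfolding hit_def by auto
      qed
      then show ?thesis using reach.detour[of S k t s d u d] s(1) up le d by simp
    qed
    \<comment> \<open>A row \<le> t that ends before column k is reachable throughout, so an
      unreachable cell lies in an arriving row.\<close>
    moreover have "k \<le> L u"
    proof (rule ccontr)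
      assume "\<not> k \<le> L u"
      then have "S (u, k) = 0" using filling_zero[OF f] by simp
      then show False using nr reach.dead[of u t S k c] ut Tpos u by simp
    qed
    ultimately show ?thesis using u c nr unfolding crosses_def by blast
  qed
  then have "\<forall>j\<in>?J. \<exists>u c. crosses j u c" by blast
  from bchoice[OF this] obtain U where "\<forall>j\<in>?J. \<exists>c. crosses j (U j) c" by blast
  from bchoice[OF this] obtain C where "\<forall>j\<in>?J. crosses j (U j) (C j)" by blast
  then have UC: "U j \<le> t" "k \<le> L (U j)" "1 \<le> C j" "C j \<le> k" "T (j, C j) = S (U j, C j)"
      "\<not> reach S k t (U j) (C j)" "C j = 1 \<or> reach S k t (U j) (C j - 1)" if "j \<in> ?J" for j
    using that unfolding crosses_def by blast+
  have "inj_on U ?J"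
  proof (rule inj_onI)
    fix i j assume ij: "i \<in> ?J" "j \<in> ?J" "U i = U j"
    \<comment> \<open>Two rows of \<open>T\<close> crossing in the same row of \<open>S\<close> do
      so in the same column, as the reachable cells there form an initial segment; they then share
      an entry of that column.\<close>
    have "C j \<le> C i" if "i \<in> ?J" "j \<in> ?J" "U i = U j" for i j
    proof (rule ccontr)
      assume "\<not> C j \<le> C i"
      then have "C i \<le> C j - 1" "C j \<noteq> 1" using UC(3)[OF that(1)] by auto
      moreover from this have "reach S k t (U j) (C j - 1)" using UC(7)[OF that(2)] by blast
      ultimately show False using reach_down[OF f _ UC(3)[OF that(1)]] UC(6)[OF that(1)] that(3) by simp
    qed
    from this[OF ij] this[OF ij(2,1) ij(3)[symmetric]] have "C i = C j" by simp
    then have "T (i, C i) = T (j, C i)" using UC(5)[OF ij(1)] UC(5)[OF ij(2)] ij(3) by simp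
    moreover have "0 < T (i, C i)"
      using UC(3,4)[OF ij(1)] ij(1) fillingD(2)[OF T, of i "C i"] by auto
    ultimately show "i = j" using fillingD(4)[OF T] by blast
  qed
  moreover have "U ` ?J \<subseteq> {r. k \<le> L r \<and> r \<le> t}" using UC(1,2) by blast
  moreover have "finite {r. k \<le> L r \<and> r \<le> t}" using filling_finite_rows[OF f k] by simp
  ultimately show ?thesis by (rule card_inj_on_le)
qed

text \<open>Leftward induction from column k, where the counts agree because the columns do, and
  within a column upward induction on w. Raising w by one matters only if w + 1 is an entry; if that
  entry is in a long row of \<open>T\<close>, the left count drops by one and the right count by at
  most one.\<close>

lemma card_long_greater_le:
  assumes T: "keylike L' T" and S: "filling L S"
    and col: "\<And>c. column T c = column S c" and c: "1 \<le> c" "c \<le> k"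
  shows "card {r. k \<le> L' r \<and> w < T (r, c)} \<le> card {r. k \<le> L r \<and> w < S (r, c)}"
proof -
  have fT: "filling L' T" and
    key: "\<And>r s c. precedes L' r s \<Longrightarrow> 0 < T (s, c) \<Longrightarrow> T (r, Suc c) \<le> T (s, c) \<Longrightarrow> T (r, c) \<le> T (s, c)"
    using keylikeD[OF T] by auto
  have k: "1 \<le> k" using c by simp
  have finT: "finite {r. k \<le> L' r \<and> P r}" and finS: "finite {r. k \<le> L r \<and> P r}" for P
    using filling_finite_rows[OF fT k] filling_finite_rows[OF S k] by auto
  show ?thesis
    using c(2)
  proof (induction arbitrary: w rule: inc_induct)
    case base
    have eq: "{r. k \<le> M r \<and> w < X (r, k)} = {r. Suc w \<le> X (r, k)}" if "filling M X" for M X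
      using fillingD(2)[OF that] by (auto simp: Suc_le_eq) (metis gr_implies_not0 neq0_conv)
    show ?case
      using card_column_ge[OF fT k, of "Suc w"] card_column_ge[OF S k, of "Suc w"] col[of k]
        eq[OF fT] eq[OF S] by simp
  next
    case (step d)
    have d: "1 \<le> d" "d < k" using step c(1) by auto
    show ?case
    proof (induction w)
      case 0
      have eq: "{r. k \<le> M r \<and> 0 < X (r, d)} = {r. k \<le> M r}" if "filling M X" for M X
        using fillingD(2)[OF that] d by auto
      show ?case using card_column[OF fT k] card_column[OF S k] col[of k] eq[OF fT] eq[OF S] by simp
    next
      case (Suc w)
      let ?A = "\<lambda>w. {r. k \<le> L' r \<and> w < T (r, d)}" and ?B = "\<lambda>w. {r. k \<le> L r \<and> w < S (r, d)}"
      show ?case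
      proof (cases "Suc w \<in> column T d")
        case False
        then have "T (r, d) \<noteq> Suc w" "S (r, d) \<noteq> Suc w" for r
          using col[of d] column_iff[of "Suc w" T d] column_iff[of "Suc w" S d] by auto
        then have "Suc w < T (r, d) \<longleftrightarrow> w < T (r, d)" "Suc w < S (r, d) \<longleftrightarrow> w < S (r, d)" for r
          using Suc_lessI by (metis Suc_lessD)+
        then show ?thesis using Suc by simp
      next
        case True
        then obtain q where q: "T (q, d) = Suc w" using column_iff by blast
        obtain p where p: "S (p, d) = Suc w" using True col[of d] column_iff by blast
        show ?thesis
        proof (cases "k \<le> L' q")
          case True
          have "?A w = insert q (?A (Suc w))"
            using True q fillingD(4)[OF fT, of q d] by (auto simp: Suc_lessI) (metis Suc_lessI)
          then have "card (?A w) = Suc (card (?A (Suc w)))" using finT q by simp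
          moreover have "?B w \<subseteq> insert p (?B (Suc w))"
            using p fillingD(4)[OF S, of p d] by (auto simp: Suc_lessI) (metis Suc_lessI)
          then have "card (?B w) \<le> card (insert p (?B (Suc w)))" by (intro card_mono) (use finS in auto)
          then have "card (?B w) \<le> Suc (card (?B (Suc w)))" using finS p by simp
          ultimately show ?thesis using Suc by simp
        next
          case False
          \<comment> \<open>The value w + 1 sits in a short row of \<open>T\<close>, which all long
            rows precede. So a long row with a larger entry here still has an entry > w + 1 in the
            next column, and the bound there applies.\<close>
          have "Suc w < T (r, Suc d)" if "r \<in> ?A (Suc w)" for r
          proof (rule ccontr)
            assume "\<not> ?thesis"
            then have "T (r, d) \<le> T (q, d)"
              using key[of r q d] q False that by (auto simp: precedes_def)
            then show False using q that by simp
          qed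
          then have "card (?A (Suc w)) \<le> card {r. k \<le> L' r \<and> Suc w < T (r, Suc d)}"
            by (intro card_mono finT) auto
          also have "\<dots> \<le> card {r. k \<le> L r \<and> Suc w < S (r, Suc d)}" by (rule step.IH)
          also have "\<dots> \<le> card (?B (Suc w))"
            by (intro card_mono finS) (use fillingD(3)[OF S d(1)] order.strict_trans2 in blast)
          finally show ?thesis .
        qed
      qed
    qed
  qed
qed

lemma set_eq_card_atMost:
  fixes X Y :: "nat set"
  assumes "finite X" "finite Y"
    and "\<And>t. card {r \<in> X. r \<le> t} = card {r \<in> Y. r \<le> t}"
  shows "X = Y"
proof -
  have mem: "t \<in> Z \<longleftrightarrow> card {r \<in> Z. r < t} \<noteq> card {r \<in> Z. r \<le> t}" if "finite Z" for t and Z :: "nat set"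
  proof (cases "t \<in> Z")
    case True
    then have "{r \<in> Z. r \<le> t} = insert t {r \<in> Z. r < t}" by auto
    then show ?thesis using True that by simp
  next
    case False
    then have "{r \<in> Z. r \<le> t} = {r \<in> Z. r < t}" by (auto simp: order.order_iff_strict)
    then show ?thesis using False by simp
  qed
  have "card {r \<in> X. r < t} = card {r \<in> Y. r < t}" for t
    using assms(3)[of "t - 1"] by (cases t) (auto simp: less_Suc_eq_le)
  then have "t \<in> X \<longleftrightarrow> t \<in> Y" for t
    using mem[OF assms(1), of t] mem[OF assms(2), of t] assms(3)[of t] by simp
  then show ?thesis by blast
qed

text \<open>The cut bounds the part of the left set up to t, the count bounds the part above t, and
  the total sizes agree.\<close>

lemma first_column_long_rows:
  assumes S: "skyline L S" and T: "keylike L' T"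
    and col: "\<And>c. column T c = column S c" and k: "1 \<le> k"
  shows "(\<lambda>r. T (r, 1)) ` {r. k \<le> L' r} = {r. k \<le> L r}" (is "?X = ?Y")
proof -
  have f: "filling L S" and S1: "\<And>r. 0 < L r \<Longrightarrow> S (r, 1) = r"
    using skylineD[OF S] by auto
  have fT: "filling L' T" using T unfolding keylike_def by blast
  have finX: "finite {r. k \<le> L' r}" and finY: "finite ?Y"
    using filling_finite_rows[OF fT k] filling_finite_rows[OF f k] by auto
  have inj: "inj_on (\<lambda>r. T (r, 1)) {r. k \<le> L' r}"
    by (rule inj_on_subset[OF filling_inj[OF fT]]) (use k in auto)
  have cX: "card {x \<in> ?X. P x} = card {r. k \<le> L' r \<and> P (T (r, 1))}" for P
  proof -
    have "{x \<in> ?X. P x} = (\<lambda>r. T (r, 1)) ` {r. k \<le> L' r \<and> P (T (r, 1))}" by auto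
    then show ?thesis
      using card_image[OF inj_on_subset[OF inj], of "{r. k \<le> L' r \<and> P (T (r, 1))}"] by auto
  qed
  have cXY: "card ?X = card ?Y"
    using card_image[OF inj] card_column[OF fT k] card_column[OF f k] col by simp
  show ?thesis
  proof (rule set_eq_card_atMost)
    show "finite ?X" using finX by simp
    show "finite ?Y" by (rule finY)
    fix t
    have split: "card Z = card {r \<in> Z. r \<le> t} + card {r \<in> Z. t < r}" if "finite Z" for Z :: "nat set"
      using that by (subst card_Un_disjoint[symmetric]) (auto intro!: arg_cong[of _ _ card])
    have "{r. k \<le> L r \<and> t < S (r, 1)} = {r \<in> ?Y. t < r}" using S1 k by auto
    then have "card {x \<in> ?X. t < x} \<le> card {r \<in> ?Y. t < r}"
      using card_long_greater_le[OF T f col order_refl k, of t] cX by simp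
    moreover have "card {x \<in> ?X. x \<le> t} \<le> card {r \<in> ?Y. r \<le> t}"
      using card_first_column_le[OF S fT col k, of t] cX by simp
    ultimately show "card {x \<in> ?X. x \<le> t} = card {r \<in> ?Y. r \<le> t}"
      using split[of ?X] split[of ?Y] finX finY cXY by simp
  qed
qed

section \<open>Translation of the definitions\<close>

text \<open>The type B inequality, propagated leftwards from the end of the shorter row, where a
  positive entry meets 0.\<close>

lemma skyline_shorter_row:
  assumes S: "skyline L S" and "r < s" "L r < L s" "1 \<le> c" "c \<le> L r"
  shows "S (r, c) < S (s, Suc c)"
proof -
  have f: "filling L S" and
    sky: "\<And>r s c. r < s \<Longrightarrow> 1 \<le> c \<Longrightarrow> S (s, Suc c) \<le> S (r, c) \<Longrightarrow> S (s, Suc c) \<le> S (r, Suc c)"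
    using skylineD[OF S] by auto
  show ?thesis using assms(5)
  proof (induction rule: inc_induct)
    case base
    have "S (r, Suc (L r)) = 0" "0 < S (s, Suc (L r))"
      using filling_zero[OF f] fillingD(2)[OF f, of s "Suc (L r)"] assms(3) by auto
    then show ?case using sky[of r s "L r"] assms by linarith
  next
    case (step n)
    have "S (s, Suc (Suc n)) \<le> S (s, Suc n)" using fillingD(3)[OF f, of "Suc n" s] by simp
    then show ?case using sky[of r s n] step assms by linarith
  qed
qed

text \<open>Recovers condition (4). The increase in the first column starts the induction, and the
  rule for the preceding longer row carries it to the right.\<close>

lemma keylike_shorter_row:
  assumes T: "keylike L T" and "T (r, 1) < T (s, 1)" "L r < L s" "1 \<le> c" "c \<le> L r"
  shows "T (r, c) < T (s, Suc c)"
proof -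
  have f: "filling L T" and
    key: "\<And>r s c. precedes L r s \<Longrightarrow> 0 < T (s, c) \<Longrightarrow> T (r, Suc c) \<le> T (s, c) \<Longrightarrow> T (r, c) \<le> T (s, c)"
    using keylikeD[OF T] by auto
  have pr: "precedes L s r" using assms(3) unfolding precedes_def by simp
  have pos: "0 < T (r, d)" if "1 \<le> d" "d \<le> c" for d
    using that fillingD(2)[OF f, of r d] assms(5) by simp
  have "T (r, d) < T (s, Suc d)" if "1 \<le> d" "d \<le> c" for d
    using that
  proof (induction rule: dec_induct)
    case base
    then show ?case using key[OF pr pos, of 1] assms(2) by force
  next
    case (step n)
    have "T (r, Suc n) \<le> T (r, n)" using fillingD(3)[OF f] step by blast
    then show ?case using key[OF pr pos, of "Suc n"] step by force
  qed
  then show ?thesis using assms(4) by blast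
qed

text \<open>Propagated leftwards from the common end of the rows. It orders the first entries within
  a length class with no assumption on the first column.\<close>

lemma keylike_equal_rows:
  assumes T: "keylike L T" and "r < s" "L r = L s" "1 \<le> c" "c \<le> L r"
  shows "T (r, c) < T (s, c)"
proof -
  have f: "filling L T" and
    key: "\<And>r s c. precedes L r s \<Longrightarrow> 0 < T (s, c) \<Longrightarrow> T (r, Suc c) \<le> T (s, c) \<Longrightarrow> T (r, c) \<le> T (s, c)"
    using keylikeD[OF T] by auto
  have pr: "precedes L r s" using assms unfolding precedes_def by simp
  have ne: "T (r, d) \<noteq> T (s, d) \<and> 0 < T (s, d)" if "1 \<le> d" "d \<le> L r" for d
    using that fillingD(2)[OF f] fillingD(4)[OF f, of r d s] assms(2,3) by auto
  show ?thesis using assms(5)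
  proof (induction rule: inc_induct)
    case base
    have "T (r, Suc (L r)) = 0" using filling_zero[OF f] by simp
    then show ?case using key[OF pr, of "L r"] ne[of "L r"] assms(4,5) by force
  next
    case (step n)
    have "T (s, Suc n) \<le> T (s, n)" using fillingD(3)[OF f] step assms(4) by simp
    then show ?case using key[OF pr, of n] ne[of n] step assms(4) by force
  qed
qed

lemma diagram_iff: "(r, c) \<in> diagram a \<longleftrightarrow> 1 \<le> c \<and> c \<le> row_length a r"
  unfolding diagram_def row_length_def rowlen_def by auto

lemma rowlen_eq: "1 \<le> row_length a r \<Longrightarrow> rowlen a r = row_length a r"
  unfolding row_length_def rowlen_def by (auto split: if_splits)

lemma finite_row_length: "finite {r. 0 < row_length a r}"
  by (rule finite_subset[of _ "{..length a}"]) (auto simp: row_length_def split: if_splits)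

lemma filling_iff:
  "filling (row_length a) S \<longleftrightarrow> is_filling a S \<and> rows_weakly_decr a S \<and> cols_distinct a S"
proof
  assume f: "filling (row_length a) S"
  show "is_filling a S \<and> rows_weakly_decr a S \<and> cols_distinct a S"
    unfolding is_filling_def rows_weakly_decr_def cols_distinct_def
    using fillingD[OF f] filling_zero[OF f] by (auto simp: diagram_iff Suc_le_eq)
next
  assume *: "is_filling a S \<and> rows_weakly_decr a S \<and> cols_distinct a S"
  then have pos: "0 < S (r, c) \<longleftrightarrow> 1 \<le> c \<and> c \<le> row_length a r" for r c
    unfolding is_filling_def using diagram_iff[of r c a] by (metis gr_zeroI less_irrefl less_one not_le)
  have "S (r, Suc c) \<le> S (r, c)" if "1 \<le> c" for r c
  proof (cases "Suc c \<le> row_length a r")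
    case True
    then show ?thesis using * that unfolding rows_weakly_decr_def by (auto simp: diagram_iff)
  next
    case False
    then show ?thesis using pos[of r "Suc c"] by simp
  qed
  moreover have "r = s" if "0 < S (r, c)" "S (r, c) = S (s, c)" for r s c
    using that * pos[of r c] pos[of s c] unfolding cols_distinct_def by (auto simp: diagram_iff)
  ultimately show "filling (row_length a) S"
    unfolding filling_def using pos finite_row_length by blast
qed

text \<open>For a type A triple the skyline rule says that \<beta> never satisfies \<alpha> <
  \<beta> \<le> \<gamma>; distinct column entries exclude \<beta> = \<alpha>.\<close>

lemma atom_fillings_iff: "S \<in> atom_fillings b \<longleftrightarrow> skyline (row_length b) S"
proof
  let ?L = "row_length b"
  assume S: "S \<in> atom_fillings b"
  then have f: "filling ?L S" unfolding filling_iff atom_fillings_def by simp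
  have S1: "S (r, 1) = r" if "0 < ?L r" for r
    using S that unfolding atom_fillings_def by (auto simp: diagram_iff Suc_le_eq)
  have A: "inv_triple (S (r, c)) (S (r, Suc c)) (S (s, Suc c))"
    if "r < s" "1 \<le> c" "Suc c \<le> ?L s" "?L s \<le> ?L r" for r s c
    using S that rowlen_eq[of b r] rowlen_eq[of b s]
    unfolding atom_fillings_def all_inv_triples_def by (auto simp: diagram_iff)
  have B: "inv_triple (S (s, c)) (S (s, Suc c)) (S (r, c))"
    if "r < s" "1 \<le> c" "c \<le> ?L r" "?L r < ?L s" for r s c
    using S that rowlen_eq[of b r] rowlen_eq[of b s]
    unfolding atom_fillings_def all_inv_triples_def by (auto simp: diagram_iff)
  \<comment> \<open>A type B triple also allows \<beta> > \<gamma>. The first column excludes this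
    at the start, since its entries are the row indices, and each strict inequality excludes it in
    the next column.\<close>
  have short: "S (r, c) < S (s, Suc c)" if "r < s" "1 \<le> c" "c \<le> ?L r" "?L r < ?L s" for r s c
    using that(2,3)
  proof (induction rule: dec_induct)
    case base
    then show ?case using B[of r s 1] S1[of r] S1[of s] that unfolding inv_triple_def by auto
  next
    case (step n)
    then show ?case using B[of r s "Suc n"] fillingD(3)[OF f, of n r] that
      unfolding inv_triple_def by auto
  qed
  have "S (s, Suc c) \<le> S (r, Suc c)" if "r < s" "1 \<le> c" "S (s, Suc c) \<le> S (r, c)" for r s c
  proof (rule ccontr)
    assume gt: "\<not> ?thesis"
    then have "Suc c \<le> ?L s" "c \<le> ?L r"
      using fillingD(2)[OF f, of s "Suc c"] fillingD(2)[OF f, of r c] that(3) by auto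
    then show False
      using short[of r s c] A[of r s c] that gt unfolding inv_triple_def by fastforce
  qed
  then show "skyline ?L S" unfolding skyline_def using f S1 by blast
next
  let ?L = "row_length b"
  assume S: "skyline ?L S"
  have f: "filling ?L S" and S1: "\<And>r. 0 < ?L r \<Longrightarrow> S (r, 1) = r" and
    sky: "\<And>r s c. r < s \<Longrightarrow> 1 \<le> c \<Longrightarrow> S (s, Suc c) \<le> S (r, c) \<Longrightarrow> S (s, Suc c) \<le> S (r, Suc c)"
    using skylineD[OF S] by auto
  have A: "inv_triple (S (r, c)) (S (r, Suc c)) (S (s, Suc c))"
    if "r < s" "1 \<le> c" "Suc c \<le> ?L s" "Suc c \<le> ?L r" for r s c
    using sky[of r s c] fillingD(3)[OF f, of c r] fillingD(2)[OF f, of s "Suc c"]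
      fillingD(4)[OF f, of s "Suc c" r] that
    unfolding inv_triple_def by force
  have B: "inv_triple (S (s, c)) (S (s, Suc c)) (S (r, c))"
    if "r < s" "1 \<le> c" "c \<le> ?L r" "?L r < ?L s" for r s c
    using skyline_shorter_row[OF S, of r s c] fillingD(3)[OF f, of c s] that
    unfolding inv_triple_def by simp
  have "all_inv_triples b S"
    unfolding all_inv_triples_def
    using A B rowlen_eq[of b] by (auto simp: diagram_iff)
  then show "S \<in> atom_fillings b"
    using f S1 unfolding atom_fillings_def filling_iff by (auto simp: diagram_iff Suc_le_eq)
qed

text \<open>If the preceding row is the lower one, the keylike rule is the contrapositive of (3); if
  it is the higher one, (4) contradicts the premise. Conversely, (4) makes (3) vacuous when the
  lower row is shorter.\<close>

lemma quasi_key_tableaux_iff: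
  "T \<in> quasi_key_tableaux a \<longleftrightarrow> keylike (row_length a) T
     \<and> (\<forall>r. 0 < row_length a r \<longrightarrow> T (r, 1) \<le> r)
     \<and> (\<forall>r s. r < s \<longrightarrow> 0 < row_length a r \<longrightarrow> 0 < row_length a s \<longrightarrow> T (r, 1) < T (s, 1))"
proof
  let ?L = "row_length a"
  assume T: "T \<in> quasi_key_tableaux a"
  then have f: "filling ?L T" unfolding filling_iff quasi_key_tableaux_def by simp
  have three: "T (s, c) < T (r, Suc c)" if "r < s" "0 < T (s, c)" "T (s, c) < T (r, c)" for r s c
    using T that fillingD(2)[OF f, of s c] fillingD(2)[OF f, of r c]
    unfolding quasi_key_tableaux_def by (auto simp: diagram_iff)
  have four: "T (r, c) < T (s, Suc c)" if "r < s" "?L r < ?L s" "1 \<le> c" "c \<le> ?L r" for r s c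
    using T that rowlen_eq[of a r] rowlen_eq[of a s]
    unfolding quasi_key_tableaux_def by (auto simp: diagram_iff)
  have "T (r, c) \<le> T (s, c)"
    if "precedes ?L r s" "0 < T (s, c)" "T (r, Suc c) \<le> T (s, c)" for r s c
  proof (cases "r < s")
    case True
    then show ?thesis using three[of r s c] that by force
  next
    case False
    then have "s < r" "?L s < ?L r" using that(1) unfolding precedes_def by (auto intro: ccontr)
    then show ?thesis using four[of s r c] that fillingD(2)[OF f, of s c] by auto
  qed
  then have "keylike ?L T" unfolding keylike_def using f by blast
  then show "keylike ?L T \<and> (\<forall>r. 0 < ?L r \<longrightarrow> T (r, 1) \<le> r)
     \<and> (\<forall>r s. r < s \<longrightarrow> 0 < ?L r \<longrightarrow> 0 < ?L s \<longrightarrow> T (r, 1) < T (s, 1))"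
    using T unfolding quasi_key_tableaux_def by (auto simp: diagram_iff Suc_le_eq)
next
  let ?L = "row_length a"
  assume *: "keylike ?L T \<and> (\<forall>r. 0 < ?L r \<longrightarrow> T (r, 1) \<le> r)
     \<and> (\<forall>r s. r < s \<longrightarrow> 0 < ?L r \<longrightarrow> 0 < ?L s \<longrightarrow> T (r, 1) < T (s, 1))"
  then have T: "keylike ?L T" and T1: "\<And>r. 0 < ?L r \<Longrightarrow> T (r, 1) \<le> r"
    and incr: "\<And>r s. r < s \<Longrightarrow> 0 < ?L r \<Longrightarrow> 0 < ?L s \<Longrightarrow> T (r, 1) < T (s, 1)" by blast+
  have f: "filling ?L T" and
    key: "\<And>r s c. precedes ?L r s \<Longrightarrow> 0 < T (s, c) \<Longrightarrow> T (r, Suc c) \<le> T (s, c) \<Longrightarrow> T (r, c) \<le> T (s, c)"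
    using keylikeD[OF T] by auto
  have four: "T (r, c) < T (s, Suc c)" if "r < s" "?L r < ?L s" "1 \<le> c" "c \<le> ?L r" for r s c
    using keylike_shorter_row[OF T incr] that by simp
  have three: "Suc c \<le> ?L r \<and> T (s, c) < T (r, Suc c)"
    if "r < s" "1 \<le> c" "c \<le> ?L r" "c \<le> ?L s" "T (s, c) < T (r, c)" for r s c
  proof -
    have "\<not> ?L r < ?L s" using four[of r s c] fillingD(3)[OF f, of c s] that by auto
    then have "precedes ?L r s" using that(1) unfolding precedes_def by auto
    then have "T (s, c) < T (r, Suc c)"
      using key[of r s c] that fillingD(2)[OF f, of s c] by force
    then show ?thesis using fillingD(2)[OF f, of r "Suc c"] by auto
  qed
  have "T (r, c) \<le> r" if "1 \<le> c" "c \<le> ?L r" for r c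
    using filling_mono[OF f order_refl that(1), of r] T1[of r] that by simp
  then show "T \<in> quasi_key_tableaux a"
    using f incr three four rowlen_eq[of a]
    unfolding quasi_key_tableaux_def filling_iff by (auto simp: diagram_iff Suc_le_eq)
qed

section \<open>Compositions with the same flattening\<close>

definition nonempty_rows :: "nat list \<Rightarrow> nat list" where
  "nonempty_rows a = filter (\<lambda>r. 0 < row_length a r) [1..<Suc (length a)]"

lemma set_nonempty_rows: "set (nonempty_rows a) = {r. 0 < row_length a r}"
  unfolding nonempty_rows_def by (auto simp: row_length_def split: if_splits)

lemma sorted_nonempty_rows: "sorted (nonempty_rows a)" "distinct (nonempty_rows a)"
  unfolding nonempty_rows_def by (auto simp: sorted_wrt_filter simp del: upt_Suc)

lemma row_length_map: "row_length (map L [1..<Suc n]) r = (if 1 \<le> r \<and> r \<le> n then L r else 0)"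
  unfolding row_length_def by (auto simp del: upt_Suc)

lemma map_row_length: "map (row_length a) [1..<Suc (length a)] = a"
  by (rule nth_equalityI) (auto simp: row_length_def simp del: upt_Suc)

lemma flat_eq: "flat a = map (row_length a) (nonempty_rows a)"
proof -
  have "flat a = filter (\<lambda>x. x \<noteq> 0) (map (row_length a) [1..<Suc (length a)])"
    using map_row_length[of a] unfolding flat_def by simp
  then show ?thesis unfolding nonempty_rows_def filter_map by (simp add: comp_def)
qed

lemma length_flat_take:
  assumes "i \<le> length a"
  shows "length (flat (take i a)) = card {r. 0 < row_length a r \<and> r \<le> i}"
proof -
  have "length (flat (take i a)) = card (set (nonempty_rows (take i a)))"
    using distinct_card[OF sorted_nonempty_rows(2)] flat_eq by (metis length_map)
  moreover have "{r. 0 < row_length (take i a) r} = {r. 0 < row_length a r \<and> r \<le> i}"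
    using assms unfolding row_length_def by (auto split: if_splits)
  ultimately show ?thesis using set_nonempty_rows by simp
qed

lemma sum_list_take_less:
  fixes f :: "nat list"
  assumes "\<forall>x\<in>set f. 0 < x" "m < m'" "m' \<le> length f"
  shows "sum_list (take m f) < sum_list (take m' f)"
proof -
  have "take m' f = take m f @ take (m' - m) (drop m f)"
    using assms(2) by (metis le_add_diff_inverse less_imp_le take_add)
  moreover have mem: "f ! m \<in> set (take (m' - m) (drop m f))"
    using assms(2,3) by (auto simp: in_set_conv_nth intro!: exI[of _ 0])
  moreover have "0 < f ! m" using assms nth_mem[of m f] by auto
  ultimately show ?thesis using member_le_sum_list[OF mem] by simp
qed

text \<open>Prefixes of both compositions flatten to prefixes of one list of positive parts, whose
  partial sums strictly increase; so comparing sums is comparing numbers of nonzero parts.\<close>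

lemma dominates_iff:
  assumes "length b = length a" "flat b = flat a"
  shows "dominates b a \<longleftrightarrow> (\<forall>i \<le> length a.
    card {r. 0 < row_length a r \<and> r \<le> i} \<le> card {r. 0 < row_length b r \<and> r \<le> i})"
proof -
  have flat_take: "flat (take i c) = take (length (flat (take i c))) (flat c)"
    and len: "length (flat (take i c)) \<le> length (flat c)" for i c
  proof -
    have "flat c = flat (take i c) @ flat (drop i c)"
      unfolding flat_def by (metis append_take_drop_id filter_append)
    then show "flat (take i c) = take (length (flat (take i c))) (flat c)"
      "length (flat (take i c)) \<le> length (flat c)"
      by (metis append_eq_conv_conj, simp)
  qed
  have sum_flat: "sum_list (flat c) = sum_list c" for c
    unfolding flat_def by (induction c) auto
  have sum: "sum_list (take i c) = sum_list (take (length (flat (take i c))) (flat c))" for i c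
    using sum_flat[of "take i c"] flat_take[of i c] by simp
  have pos: "\<forall>x\<in>set (flat a). 0 < x" unfolding flat_def by auto
  have "sum_list (take i a) \<le> sum_list (take i b) \<longleftrightarrow>
      length (flat (take i a)) \<le> length (flat (take i b))" for i
  proof -
    let ?m = "length (flat (take i a))" and ?m' = "length (flat (take i b))"
    have bd: "?m \<le> length (flat a)" "?m' \<le> length (flat a)"
      using len[of i a] len[of i b] assms(2) by auto
    have "sum_list (take i a) \<le> sum_list (take i b) \<longleftrightarrow>
        sum_list (take ?m (flat a)) \<le> sum_list (take ?m' (flat a))"
      using sum[of i a] sum[of i b] assms(2) by simp
    also have "\<dots> \<longleftrightarrow> ?m \<le> ?m'"
      using sum_list_take_less[OF pos, of ?m ?m'] sum_list_take_less[OF pos, of ?m' ?m] bd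
      by (cases ?m ?m' rule: linorder_cases) auto
    finally show ?thesis .
  qed
  then show ?thesis
    unfolding dominates_def using length_flat_take[of _ a] length_flat_take[of _ b] assms(1) by simp
qed

text \<open>Monotonicity of \<rho> preserves the order of the parts, and moving rows down gives
  dominance. The intended \<rho> sends a row to its first entry.\<close>

lemma lowered_composition:
  assumes incr: "\<And>r s. 0 < row_length a r \<Longrightarrow> 0 < row_length a s \<Longrightarrow> r < s \<Longrightarrow> \<rho> r < \<rho> s"
    and low: "\<And>r. 0 < row_length a r \<Longrightarrow> 1 \<le> \<rho> r \<and> \<rho> r \<le> r"
    and L: "\<And>r. 0 < row_length a r \<Longrightarrow> L (\<rho> r) = row_length a r"
    and supp: "{r. 0 < L r} = \<rho> ` {r. 0 < row_length a r}"
  shows "\<exists>b. row_length b = L \<and> length b = length a \<and> flat b = flat a \<and> dominates b a"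
proof -
  define b where "b = map L [1..<Suc (length a)]"
  have len: "length b = length a" unfolding b_def by (simp del: upt_Suc)
  have in_range: "1 \<le> r \<and> r \<le> length a" if "0 < L r" for r
  proof -
    have "r \<in> {r. 0 < L r}" using that by simp
    then obtain q where q: "0 < row_length a q" "r = \<rho> q" unfolding supp by auto
    then have "q \<le> length a" unfolding row_length_def by (auto split: if_splits)
    then show ?thesis using low[OF q(1)] q(2) by simp
  qed
  have "row_length b r = L r" for r
    using in_range[of r] unfolding b_def row_length_map by (cases "L r = 0") auto
  then have rb: "row_length b = L" by blast
  have "map \<rho> (nonempty_rows a) = nonempty_rows b"
  proof (rule sorted_distinct_set_unique)
    have "sorted_wrt (\<lambda>r s. \<rho> r < \<rho> s) (nonempty_rows a)"
      by (rule sorted_wrt_mono_rel[of _ "(<)"])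
        (use incr set_nonempty_rows[of a] sorted_nonempty_rows[of a] in
          \<open>auto simp: strict_sorted_iff\<close>)
    then have "sorted_wrt (<) (map \<rho> (nonempty_rows a))" by (simp add: sorted_wrt_map)
    then show "sorted (map \<rho> (nonempty_rows a))" "distinct (map \<rho> (nonempty_rows a))"
      by (auto simp: strict_sorted_iff)
    show "set (map \<rho> (nonempty_rows a)) = set (nonempty_rows b)"
      using supp rb set_nonempty_rows[of a] set_nonempty_rows[of b] by simp
  qed (rule sorted_nonempty_rows)+
  then have "flat b = map L (map \<rho> (nonempty_rows a))" using flat_eq[of b] rb by simp
  also have "\<dots> = flat a" using L set_nonempty_rows[of a] by (simp add: flat_eq)
  finally have fl: "flat b = flat a" .
  have "card {r. 0 < row_length a r \<and> r \<le> i} \<le> card {r. 0 < L r \<and> r \<le> i}" for i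
  proof (rule card_inj_on_le[of \<rho>])
    show "inj_on \<rho> {r. 0 < row_length a r \<and> r \<le> i}"
      by (rule inj_onI) (use incr in \<open>metis (mono_tags) less_irrefl linorder_neqE_nat mem_Collect_eq\<close>)
    show "\<rho> ` {r. 0 < row_length a r \<and> r \<le> i} \<subseteq> {r. 0 < L r \<and> r \<le> i}"
      using low L by (auto intro: order_trans)
    show "finite {r. 0 < L r \<and> r \<le> i}" by simp
  qed
  then have "dominates b a" using dominates_iff[OF len fl] rb by simp
  then show ?thesis using rb len fl by blast
qed

lemma raising_rows:
  assumes len: "length b = length a" and fl: "flat b = flat a" and dom: "dominates b a"
  obtains \<sigma> where
    "\<And>r s. 0 < row_length b r \<Longrightarrow> 0 < row_length b s \<Longrightarrow> r < s \<Longrightarrow> \<sigma> r < \<sigma> s"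
    "\<And>r. 0 < row_length b r \<Longrightarrow> r \<le> \<sigma> r \<and> row_length a (\<sigma> r) = row_length b r"
    "\<sigma> ` {r. 0 < row_length b r} = {r. 0 < row_length a r}"
proof -
  let ?pa = "nonempty_rows a" and ?pb = "nonempty_rows b"
  have lp: "length ?pa = length ?pb" using fl flat_eq[of a] flat_eq[of b] by (metis length_map)
  define \<sigma> where "\<sigma> r = the (map_of (zip ?pb ?pa) r)" for r
  have \<sigma>: "\<sigma> (?pb ! i) = ?pa ! i" if "i < length ?pb" for i
    unfolding \<sigma>_def using map_of_zip_nth[OF lp[symmetric] sorted_nonempty_rows(2)] that lp by simp
  have sa: "sorted_wrt (<) ?pa" and sb: "sorted_wrt (<) ?pb"
    using sorted_nonempty_rows by (auto simp: strict_sorted_iff)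
  have idx: "\<exists>i < length ?pb. r = ?pb ! i" if "0 < row_length b r" for r
    using that set_nonempty_rows[of b] by (metis in_set_conv_nth mem_Collect_eq)
  show thesis
  proof
    fix r s assume rs: "0 < row_length b r" "0 < row_length b s" "r < s"
    obtain i j where ij: "i < length ?pb" "j < length ?pb" "r = ?pb ! i" "s = ?pb ! j"
      using idx rs by metis
    then have "i < j" using sb rs(3) by (metis linorder_neqE_nat less_asym sorted_wrt_nth_less)
    then show "\<sigma> r < \<sigma> s" using \<sigma> ij sa lp by (simp add: sorted_wrt_nth_less)
  next
    fix r assume "0 < row_length b r"
    then obtain i where i: "i < length ?pb" "r = ?pb ! i" using idx by blast
    have "row_length a (?pa ! i) = row_length b (?pb ! i)"
      using fl i(1) lp flat_eq[of a] flat_eq[of b] by (metis nth_map)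
    \<comment> \<open>Otherwise, up to height \<open>?pa ! i\<close>, a has at least i + 1 nonempty
      rows but b at most i (positions count from 0), against dominance.\<close>
    moreover have "?pb ! i \<le> ?pa ! i"
    proof (rule ccontr)
      assume "\<not> ?thesis"
      then have gt: "?pa ! i < ?pb ! i" by simp
      have "?pa ! i \<in> set ?pa" using i(1) lp by simp
      then have "?pa ! i \<le> length a"
        using set_nonempty_rows[of a] unfolding row_length_def by (auto split: if_splits)
      then have "card {r. 0 < row_length a r \<and> r \<le> ?pa ! i} \<le> card {r. 0 < row_length b r \<and> r \<le> ?pa ! i}"
        using dom dominates_iff[OF len fl] by blast
      also have "\<dots> \<le> card ((!) ?pb ` {..<i})"
      proof (rule card_mono)
        show "{r. 0 < row_length b r \<and> r \<le> ?pa ! i} \<subseteq> (!) ?pb ` {..<i}"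
        proof
          fix r assume r: "r \<in> {r. 0 < row_length b r \<and> r \<le> ?pa ! i}"
          then obtain j where j: "j < length ?pb" "r = ?pb ! j" using idx by blast
          have "j < i"
          proof (rule ccontr)
            assume "\<not> j < i"
            then have "?pb ! i \<le> ?pb ! j" using sorted_nonempty_rows(1)[of b] j(1) sorted_nth_mono by force
            then show False using gt r j(2) by simp
          qed
          then show "r \<in> (!) ?pb ` {..<i}" using j(2) by blast
        qed
      qed simp
      also have "\<dots> \<le> i" using card_image_le[of "{..<i}" "(!) ?pb"] by simp
      finally have "card {r. 0 < row_length a r \<and> r \<le> ?pa ! i} \<le> i" .
      moreover have "(!) ?pa ` {..i} \<subseteq> {r. 0 < row_length a r \<and> r \<le> ?pa ! i}"
      proof
        fix r assume "r \<in> (!) ?pa ` {..i}"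
        then obtain j where j: "j \<le> i" "r = ?pa ! j" by blast
        then have "r \<in> set ?pa" using i(1) lp by simp
        moreover have "r \<le> ?pa ! i"
          using j i(1) lp sorted_nonempty_rows(1)[of a] sorted_nth_mono by force
        ultimately show "r \<in> {r. 0 < row_length a r \<and> r \<le> ?pa ! i}" using set_nonempty_rows[of a] by blast
      qed
      then have "card ((!) ?pa ` {..i}) \<le> card {r. 0 < row_length a r \<and> r \<le> ?pa ! i}"
        by (rule card_mono[rotated]) simp
      moreover have "inj_on ((!) ?pa) {..i}"
        using sorted_nonempty_rows(2)[of a] i(1) lp by (auto simp: inj_on_def nth_eq_iff_index_eq)
      then have "card ((!) ?pa ` {..i}) = Suc i" by (simp add: card_image)
      ultimately show False by simp
    qed
    ultimately show "r \<le> \<sigma> r \<and> row_length a (\<sigma> r) = row_length b r" using \<sigma> i by simp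
  next
    have "\<sigma> ` set ?pb = set ?pa"
    proof (rule equalityI)
      show "\<sigma> ` set ?pb \<subseteq> set ?pa" using \<sigma> lp by (auto simp: in_set_conv_nth) blast
      show "set ?pa \<subseteq> \<sigma> ` set ?pb"
      proof
        fix r assume "r \<in> set ?pa"
        then obtain i where "i < length ?pb" "r = ?pa ! i" using lp by (auto simp: in_set_conv_nth)
        then show "r \<in> \<sigma> ` set ?pb" using \<sigma>[of i] by (metis image_eqI nth_mem)
      qed
    qed
    then show "\<sigma> ` {r. 0 < row_length b r} = {r. 0 < row_length a r}"
      using set_nonempty_rows by simp
  qed
qed

section \<open>The bijection\<close>

text \<open>A rigidity property of well-orders, which identifies the first entries within one length
  class.\<close>

lemma strict_mono_self_map:
  fixes f :: "nat \<Rightarrow> nat"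
  assumes "f ` A = A" and mono: "\<And>x y. x \<in> A \<Longrightarrow> y \<in> A \<Longrightarrow> x < y \<Longrightarrow> f x < f y" and "x \<in> A"
  shows "f x = x"
  using assms(3)
proof (induction x rule: less_induct)
  case (less x)
  obtain z where z: "z \<in> A" "f z = x" using assms(1) less(2) by (metis imageE)
  have fx: "f x \<in> A" using assms(1) less(2) by blast
  show ?case
  proof (cases z x rule: linorder_cases)
    case less
    then show ?thesis using less.IH[OF less z(1)] z(2) by simp
  next
    case equal
    then show ?thesis using z by simp
  next
    case greater
    then have "f x < x" using mono[OF less.prems z(1)] z(2) by simp
    then show ?thesis using less.IH[OF _ fx] mono[OF fx less.prems] by simp
  qed
qed

lemma quasi_key_to_atom:
  assumes "T \<in> quasi_key_tableaux a"
  shows "\<exists>b S. length b = length a \<and> dominates b a \<and> flat b = flat a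
    \<and> S \<in> atom_fillings b \<and> (\<forall>c. column T c = column S c)"
proof -
  let ?A = "row_length a"
  have T: "keylike ?A T" and T1: "\<And>r. 0 < ?A r \<Longrightarrow> T (r, 1) \<le> r"
    and incr: "\<And>r s. r < s \<Longrightarrow> 0 < ?A r \<Longrightarrow> 0 < ?A s \<Longrightarrow> T (r, 1) < T (s, 1)"
    using assms unfolding quasi_key_tableaux_iff by blast+
  have f: "filling ?A T" using T unfolding keylike_def by blast
  obtain L S where S: "skyline L S" and col: "\<And>c. column S c = column T c"
    using skyline_exists[OF f] by blast
  have long: "(\<lambda>r. T (r, 1)) ` {r. k \<le> ?A r} = {r. k \<le> L r}" if "1 \<le> k" for k
    using first_column_long_rows[OF S T col[symmetric] that] .
  have inj: "inj_on (\<lambda>r. T (r, 1)) {r. 1 \<le> ?A r}" using filling_inj[OF f, of 1] by simp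
  \<comment> \<open>By \<open>long\<close>, row r of \<open>T\<close> and row
    \<open>T (r, 1)\<close> of \<open>S\<close> pass every length threshold k \<ge> 1
    together.\<close>
  have len: "L (T (r, 1)) = ?A r" if r: "0 < ?A r" for r
  proof (rule antisym)
    have "T (r, 1) \<in> {q. ?A r \<le> L q}" using long[of "?A r"] r by (auto simp: Suc_le_eq)
    then show "?A r \<le> L (T (r, 1))" by simp
    let ?k = "L (T (r, 1))"
    have k: "1 \<le> ?k" using \<open>?A r \<le> ?k\<close> r by simp
    then have "T (r, 1) \<in> (\<lambda>r. T (r, 1)) ` {r. ?k \<le> ?A r}" using long[OF k] by simp
    then obtain q where q: "T (r, 1) = T (q, 1)" "?k \<le> ?A q" by blast
    then have "r = q" using inj_onD[OF inj, of r q] k r by simp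
    then show "?k \<le> ?A r" using q by simp
  qed
  have "\<exists>b. row_length b = L \<and> length b = length a \<and> flat b = flat a \<and> dominates b a"
  proof (rule lowered_composition[where \<rho> = "\<lambda>r. T (r, 1)"])
    fix r assume "0 < ?A r"
    then show "1 \<le> T (r, 1) \<and> T (r, 1) \<le> r" using T1 fillingD(2)[OF f, of r 1] by (simp add: Suc_le_eq)
  next
    show "{r. 0 < L r} = (\<lambda>r. T (r, 1)) ` {r. 0 < ?A r}" using long[of 1] by (simp add: Suc_le_eq)
  qed (use incr len in auto)
  then show ?thesis using S col atom_fillings_iff by metis
qed

text \<open>Being keylike does not order first entries across different lengths. They are therefore
  identified class by class, and the increase of the whole column then comes from that of
  \<sigma>.\<close>

lemma atom_to_quasi_key:
  assumes len: "length b = length a" and dom: "dominates b a" and fl: "flat b = flat a"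
    and "S \<in> atom_fillings b"
  shows "\<exists>T \<in> quasi_key_tableaux a. \<forall>c. column T c = column S c"
proof -
  let ?A = "row_length a" and ?B = "row_length b"
  have S: "skyline ?B S" using assms(4) atom_fillings_iff by blast
  then have fS: "filling ?B S" unfolding skyline_def by blast
  obtain \<sigma> where incr: "\<And>r s. 0 < ?B r \<Longrightarrow> 0 < ?B s \<Longrightarrow> r < s \<Longrightarrow> \<sigma> r < \<sigma> s"
    and up: "\<And>r. 0 < ?B r \<Longrightarrow> r \<le> \<sigma> r \<and> ?A (\<sigma> r) = ?B r"
    and img: "\<sigma> ` {r. 0 < ?B r} = {r. 0 < ?A r}"
    using raising_rows[OF len fl dom] by metis
  have inj\<sigma>: "inj_on \<sigma> {r. 0 < ?B r}"
  proof (rule inj_onI)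
    fix r s assume "r \<in> {r. 0 < ?B r}" "s \<in> {r. 0 < ?B r}" "\<sigma> r = \<sigma> s"
    then show "r = s" using incr[of r s] incr[of s r] by (cases r s rule: linorder_cases) auto
  qed
  have pre: "\<exists>q. 0 < ?B q \<and> r = \<sigma> q" if "0 < ?A r" for r
  proof -
    have "r \<in> \<sigma> ` {r. 0 < ?B r}" using that img by simp
    then show ?thesis by auto
  qed
  \<comment> \<open>The condition on 0 leaves out the empty rows, about which nothing is known of
    \<sigma>.\<close>
  have img_class: "{r. P (?A r)} = \<sigma> ` {r. P (?B r)}" if "\<not> P 0" for P
  proof (rule set_eqI)
    fix r
    show "r \<in> {r. P (?A r)} \<longleftrightarrow> r \<in> \<sigma> ` {r. P (?B r)}"
    proof
      assume r: "r \<in> {r. P (?A r)}"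
      then have "0 < ?A r" using that by (auto intro: Nat.gr0I)
      then obtain q where "0 < ?B q" "r = \<sigma> q" using pre by blast
      then show "r \<in> \<sigma> ` {r. P (?B r)}" using r up[of q] by auto
    next
      assume "r \<in> \<sigma> ` {r. P (?B r)}"
      then obtain q where q: "P (?B q)" "r = \<sigma> q" by blast
      then have "0 < ?B q" using that by (auto intro: Nat.gr0I)
      then show "r \<in> {r. P (?A r)}" using up[of q] q by simp
    qed
  qed
  have "card {r. c \<le> ?A r} = card {r. c \<le> ?B r}" if c: "1 \<le> c" for c
  proof -
    have "{r. c \<le> ?B r} \<subseteq> {r. 0 < ?B r}" using c by auto
    then show ?thesis
      using card_image[OF inj_on_subset[OF inj\<sigma>]] img_class[of "\<lambda>l. c \<le> l"] c by simp
  qed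
  then obtain T where T: "keylike ?A T" and col: "\<And>c. column T c = column S c"
    using keylike_exists[OF fS finite_row_length] by blast
  have f: "filling ?A T" using T unfolding keylike_def by blast
  have long: "(\<lambda>r. T (r, 1)) ` {r. k \<le> ?A r} = {r. k \<le> ?B r}" if "1 \<le> k" for k
    using first_column_long_rows[OF S T col that] .
  \<comment> \<open>Rows of length exactly l are a difference of two threshold sets; taking images
    commutes with it because first entries are distinct.\<close>
  have cls: "(\<lambda>r. T (r, 1)) ` {r. ?A r = l} = {r. ?B r = l}" if l: "1 \<le> l" for l
  proof -
    have diff: "{r. M r = l} = {r. l \<le> M r} - {r. Suc l \<le> M r}" for M :: "nat \<Rightarrow> nat" by auto
    have "inj_on (\<lambda>r. T (r, 1)) {r. l \<le> ?A r}"
      by (rule inj_on_subset[OF filling_inj[OF f, of 1]]) (use l in auto)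
    then have "(\<lambda>r. T (r, 1)) ` {r. ?A r = l} = {r. l \<le> ?B r} - {r. Suc l \<le> ?B r}"
      unfolding diff[of ?A] using long[OF l] long[of "Suc l"]
      by (subst inj_on_image_set_diff[where C = "{r. l \<le> ?A r}"]) auto
    then show ?thesis using diff[of ?B] by simp
  qed
  \<comment> \<open>Both \<sigma> and the first entries increase within a length class, and the
    composite maps the class onto itself.\<close>
  have first: "T (\<sigma> r, 1) = r" if r: "0 < ?B r" for r
  proof (rule strict_mono_self_map[where A = "{q. ?B q = ?B r}"])
    show "(\<lambda>r. T (\<sigma> r, 1)) ` {q. ?B q = ?B r} = {q. ?B q = ?B r}"
      using cls[of "?B r"] img_class[of "\<lambda>l. l = ?B r"] r by (simp add: image_image)
    show "T (\<sigma> p, 1) < T (\<sigma> q, 1)"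
      if "p \<in> {q. ?B q = ?B r}" "q \<in> {q. ?B q = ?B r}" "p < q" for p q
      using keylike_equal_rows[OF T incr[of p q]] up[of p] up[of q] that r by (simp add: Suc_le_eq)
  qed simp
  have "T (r, 1) \<le> r" if "0 < ?A r" for r
    using pre[OF that] first up by auto
  moreover have "T (r, 1) < T (s, 1)" if rs: "r < s" "0 < ?A r" "0 < ?A s" for r s
  proof -
    obtain p q where pq: "0 < ?B p" "0 < ?B q" "r = \<sigma> p" "s = \<sigma> q" using pre rs by metis
    then have "p < q" using incr[of q p] rs(1) by (cases p q rule: linorder_cases) auto
    then show ?thesis using first pq by simp
  qed
  ultimately have "T \<in> quasi_key_tableaux a" unfolding quasi_key_tableaux_iff using T by blast
  then show ?thesis using col by blast
qed

text \<open>Values are tagged with their column, since a value may occur in several columns but only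
  once in each.\<close>

lemma monom_eq_columns:
  assumes f: "filling (row_length a) T"
  shows "monom a x T = (\<Prod>(c, v) \<in> {(c, v). v \<in> column T c}. x v)"
proof -
  let ?h = "\<lambda>(r, c). (c, T (r, c))"
  have "inj_on ?h (diagram a)"
  proof (rule inj_onI)
    fix p q assume "p \<in> diagram a" "q \<in> diagram a" "?h p = ?h q"
    then show "p = q" using fillingD(2,4)[OF f] by (cases p; cases q) (auto simp: diagram_iff)
  qed
  moreover have "?h ` diagram a = {(c, v). v \<in> column T c}"
  proof (intro set_eqI iffI)
    fix y assume "y \<in> ?h ` diagram a"
    then obtain r c where "(r, c) \<in> diagram a" "y = (c, T (r, c))" by auto
    then show "y \<in> {(c, v). v \<in> column T c}"
      using fillingD(2)[OF f, of r c] by (auto simp: column_iff diagram_iff)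
  next
    fix y assume "y \<in> {(c, v). v \<in> column T c}"
    then obtain r c where rc: "y = (c, T (r, c))" "T (r, c) \<noteq> 0" by (auto simp: column_iff)
    then have "(r, c) \<in> diagram a" using fillingD(2)[OF f, of r c] by (auto simp: diagram_iff)
    then show "y \<in> ?h ` diagram a" using rc(1) by (auto intro: rev_image_eqI)
  qed
  ultimately have "(\<Prod>(c, v) \<in> {(c, v). v \<in> column T c}. x v)
      = (\<Prod>p \<in> diagram a. (case ?h p of (c, v) \<Rightarrow> x v))"
    by (metis (no_types, lifting) prod.reindex_cong)
  also have "\<dots> = (\<Prod>p \<in> diagram a. x (T p))" by (rule prod.cong) auto
  finally show ?thesis unfolding monom_def by simp
qed

section \<open>Finiteness of the index sets and the final sum\<close>

lemma finite_diagram: "finite (diagram a)"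
proof (rule finite_subset)
  show "diagram a \<subseteq> (SIGMA r:{..length a}. {..row_length a r})"
    by (auto simp: diagram_iff) (auto simp: row_length_def split: if_splits)
qed simp

lemma finite_atom_fillings: "finite (atom_fillings b)"
proof (rule finite_subset)
  let ?F = "{S. \<forall>p. (p \<in> diagram b \<longrightarrow> S p \<in> {..length b}) \<and> (p \<notin> diagram b \<longrightarrow> S p = (0::nat))}"
  show "atom_fillings b \<subseteq> ?F"
  proof
    fix S assume S: "S \<in> atom_fillings b"
    then have sky: "skyline (row_length b) S" using atom_fillings_iff by blast
    then have f: "filling (row_length b) S" unfolding skyline_def by blast
    have "S (r, c) \<le> length b" if "(r, c) \<in> diagram b" for r c
    proof -
      have *: "1 \<le> c" "c \<le> row_length b r" using that diagram_iff by auto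
      then have "S (r, 1) = r" using sky unfolding skyline_def by auto
      moreover have "r \<le> length b" using * unfolding row_length_def by (auto split: if_splits)
      ultimately show ?thesis using filling_mono[OF f order_refl *(1), of r] by simp
    qed
    then show "S \<in> ?F" using S unfolding atom_fillings_def is_filling_def by auto
  qed
  show "finite ?F" by (rule finite_set_of_finite_funs[OF finite_diagram]) simp
qed

lemma finite_same_flat: "finite {b. length b = length a \<and> dominates b a \<and> flat b = flat a}"
proof (rule finite_subset)
  have "set b \<subseteq> insert 0 (set (flat b))" for b unfolding flat_def by auto
  then show "{b. length b = length a \<and> dominates b a \<and> flat b = flat a}
      \<subseteq> {b. set b \<subseteq> insert 0 (set (flat a)) \<and> length b = length a}"
    by (auto; metis insertE subsetD)
  show "finite {b. set b \<subseteq> insert 0 (set (flat a)) \<and> length b = length a}"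
    by (rule finite_lists_length_eq) simp
qed

lemma quasikey_eq_sum_pairs:
  fixes x :: "nat \<Rightarrow> 'a::comm_semiring_1"
  shows "quasikey a x = (\<Sum>(b, S) \<in> (SIGMA b:{b. length b = length a \<and> dominates b a \<and> flat b = flat a}.
    atom_fillings b). monom b x S)"
proof -
  let ?I = "{b. length b = length a \<and> dominates b a \<and> flat b = flat a}"
  let ?Q = "quasi_key_tableaux a"
  define P where "P = Sigma ?I atom_fillings"
  have P: "(b, S) \<in> P \<longleftrightarrow> length b = length a \<and> dominates b a \<and> flat b = flat a \<and> S \<in> atom_fillings b"
    for b S unfolding P_def by auto
  have "\<forall>T\<in>?Q. \<exists>p. p \<in> P \<and> (\<forall>c. column T c = column (snd p) c)"
    using quasi_key_to_atom P by fastforce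
  from bchoice[OF this] obtain F where
    F: "\<And>T. T \<in> ?Q \<Longrightarrow> F T \<in> P" "\<And>T c. T \<in> ?Q \<Longrightarrow> column T c = column (snd (F T)) c" by blast
  have "\<forall>p\<in>P. \<exists>T. T \<in> ?Q \<and> (\<forall>c. column T c = column (snd p) c)"
    using atom_to_quasi_key P by fastforce
  from bchoice[OF this] obtain G where
    G: "\<And>p. p \<in> P \<Longrightarrow> G p \<in> ?Q" "\<And>p c. p \<in> P \<Longrightarrow> column (G p) c = column (snd p) c" by blast
  have uniqT: "T = T'" if "T \<in> ?Q" "T' \<in> ?Q" "\<And>c. column T c = column T' c" for T T'
    using keylike_unique[OF _ _ that(3)] that(1,2) quasi_key_tableaux_iff by blast
  \<comment> \<open>The columns determine \<open>S\<close>, its positive entries determine the row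
    lengths, and the fixed length of b accounts for trailing zeros.\<close>
  have uniqP: "p = p'" if p: "p \<in> P" "p' \<in> P" and col: "\<And>c. column (snd p) c = column (snd p') c" for p p'
  proof -
    obtain b S b' S' where eq: "p = (b, S)" "p' = (b', S')" by fastforce
    have S: "skyline (row_length b) S" "skyline (row_length b') S'"
      using p eq P atom_fillings_iff by auto
    then have SS': "S = S'" using skyline_unique col eq by auto
    have "row_length b r = row_length b' r" for r
    proof -
      have "filling (row_length b) S" "filling (row_length b') S" using S SS' unfolding skyline_def by auto
      then have "1 \<le> c \<and> c \<le> row_length b r \<longleftrightarrow> 1 \<le> c \<and> c \<le> row_length b' r" for c
        using fillingD(2) by blast
      from this[of "row_length b r"] this[of "row_length b' r"] show ?thesis by linarith
    qed
    moreover have "length b = length b'" using p eq P by simp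
    ultimately have "b = b'" using map_row_length[of b] map_row_length[of b'] by (metis map_ext)
    then show ?thesis using eq SS' by simp
  qed
  show ?thesis
    unfolding quasikey_def P_def[symmetric]
  proof (rule sum.reindex_bij_witness[where i = G and j = F])
    fix T assume T: "T \<in> ?Q"
    show "F T \<in> P" using F T by blast
    show "G (F T) = T" using uniqT G F T by metis
    obtain b S where bS: "F T = (b, S)" by fastforce
    then have "S \<in> atom_fillings b" using F(1)[OF T] P by simp
    then have "filling (row_length b) S" using atom_fillings_iff skyline_def by blast
    moreover have "filling (row_length a) T" using T quasi_key_tableaux_iff keylike_def by blast
    ultimately show "(case F T of (b, S) \<Rightarrow> monom b x S) = monom a x T"
      using F(2)[OF T] bS by (simp add: monom_eq_columns)
  next
    fix p assume p: "p \<in> P"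
    show "G p \<in> ?Q" using G p by blast
    show "F (G p) = p" using uniqP[OF F(1)[OF G(1)[OF p]] p] F(2)[OF G(1)[OF p]] G(2)[OF p] by simp
  qed
qed

theorem theorem3p4:
  fixes a :: "nat list" and x :: "nat \<Rightarrow> 'a::comm_semiring_1"
  shows "quasikey a x =
    (\<Sum>b \<in> {b. length b = length a \<and> dominates b a \<and> flat b = flat a}. atom b x)"
proof -
  let ?I = "{b. length b = length a \<and> dominates b a \<and> flat b = flat a}"
  have "quasikey a x = (\<Sum>b\<in>?I. \<Sum>S\<in>atom_fillings b. monom b x S)"
    unfolding quasikey_eq_sum_pairs
    by (rule sum.Sigma[symmetric]) (use finite_same_flat finite_atom_fillings in auto)
  then show ?thesis unfolding atom_def .
qed

end
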